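(* There exists a (simple) polygon with exactly $22$ edges containing a pair of points that do not illuminate each other. Consequently, the minimal number of edges of a polygon having at least one pair of points that do not illuminate each other is at most $22$.
   Context: A billiard trajectory in a polygon is a path of straight segments inside the polygon reflecting off the interiors of edges with angle of incidence equal to angle of reflection (stopping upon hitting a vertex). Two points illuminate each other if some billiard trajectory connects them. *)

theory Defs
  imports "HOL-Analysis.Analysis"
begin

definition pvert :: "(real^2) list \<Rightarrow> nat \<Rightarrow> real^2" where
  "pvert vs i = vs ! (i mod length vs)"

definition pedge :: "(real^2) list \<Rightarrow> nat \<Rightarrow> (real^2) set" where
  "pedge vs i = closed_segment (pvert vs i) (pvert vs (Suc i))"

definition pboundary :: "(real^2) list \<Rightarrow> (real^2) set" where
  "pboundary vs = (\<Union>i<length vs. pedge vs i)"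

text \<open>Simple polygon with exactly length vs edges: distinct vertices, no two consecutive
  edges collinear (so every listed vertex is a genuine corner), adjacent edges meet only in
  their common vertex, non-adjacent edges are disjoint.\<close>

definition simple_polygon :: "(real^2) list \<Rightarrow> bool" where
  "simple_polygon vs \<longleftrightarrow>
     length vs \<ge> 3 \<and> distinct vs \<and>
     (\<forall>i < length vs. \<not> collinear {pvert vs i, pvert vs (Suc i), pvert vs (Suc (Suc i))}) \<and>
     (\<forall>i < length vs. \<forall>j < length vs. i \<noteq> j \<longrightarrow>
        pedge vs i \<inter> pedge vs j =
          (if j = Suc i mod length vs then {pvert vs j}
           else if i = Suc j mod length vs then {pvert vs i}
           else {}))"

definition pregion :: "(real^2) list \<Rightarrow> (real^2) set" where
  "pregion vs = inside (pboundary vs)"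

definition reflect_dir :: "real^2 \<Rightarrow> real^2 \<Rightarrow> real^2" where
  "reflect_dir d u = (2 * (u \<bullet> d) / (d \<bullet> d)) *\<^sub>R d - u"

definition reflects_at :: "(real^2) list \<Rightarrow> real^2 \<Rightarrow> real^2 \<Rightarrow> real^2 \<Rightarrow> bool" where
  "reflects_at vs p q r \<longleftrightarrow>
     (\<exists>i < length vs. q \<in> open_segment (pvert vs i) (pvert vs (Suc i)) \<and>
        (\<exists>c > 0. r - q = c *\<^sub>R reflect_dir (pvert vs (Suc i) - pvert vs i) (q - p)))"

text \<open>A billiard trajectory from x to y: finitely many straight segments, each (apart from
  its endpoints) lying in the interior region, with intermediate points in the interior of
  edges satisfying the reflection law (so the path never meets a vertex).\<close>

definition billiard_path :: "(real^2) list \<Rightarrow> (real^2) list \<Rightarrow> bool" where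
  "billiard_path vs ps \<longleftrightarrow>
     length ps \<ge> 2 \<and>
     (\<forall>j. Suc j < length ps \<longrightarrow> ps ! j \<noteq> ps ! Suc j \<and>
            open_segment (ps ! j) (ps ! Suc j) \<subseteq> pregion vs) \<and>
     (\<forall>j. 0 < j \<and> Suc j < length ps \<longrightarrow> reflects_at vs (ps ! (j - 1)) (ps ! j) (ps ! Suc j))"

definition illuminates :: "(real^2) list \<Rightarrow> real^2 \<Rightarrow> real^2 \<Rightarrow> bool" where
  "illuminates vs x y \<longleftrightarrow>
     (\<exists>ps. billiard_path vs ps \<and> hd ps = x \<and> last ps = y)"

end

(* The room consists of the staircase Q = [-1,1]x[0,1] u [0,1]x[1,2] u [1,2]x[1,3] and its mirror images
   in y = 0 and x = 2.  It folds onto Q; the points (0,0) and (2,2) lie on edges of Q.  Unfold a path from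
   (0,0) to (2,2) to a segment from (0,0) to a vector of even integers, and let v be the primitive integer
   vector in its direction.  The odd multiples of v have an odd coordinate, so there the path must be at
   an integer point that is not a corner of the room: every such point folds to a right-angled corner of
   Q, from which the folded path retraces its way.  Hence at all even multiples of v the folded path is
   back at (0,0), and it never reaches (2,2). *)
theory Submission
  imports Defs
begin

section \<open>Simplicity of the room\<close>

text \<open>\<open>Q\<close> itself cannot be the room, as both points would lie on its boundary;
  reflecting it in the two edges that carry them moves them into the open region. \<open>Q\<close>
  has 10 edges: two become mirror lines, and each image brings 9 edges. At the ends (-1,0), (1,0),
  (2,1), (2,3) of the mirror lines an edge merges with its image, which leaves 8 + 9 + 9 - 4 = 22.

  In place of a folding map, a path is followed only through the label of the square of
  \<open>Q\<close> to which its current unit square folds. A grid line acts on labels by an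
  involution that depends on its direction and parity alone, so the unfolded line dictates how
  labels change. The obstacle is a time at which two grid lines are met at once: there no such rule
  applies, and the squares around each possible integer point have to be inspected. At even points
  the label itself is not controlled, only whether it belongs to {0,1} (around images of (0,0)) or
  to {3,4} (around images of (2,2)); this suffices to tell source from target. The endpoint is an
  even multiple of \<open>v\<close> because both of its unfolded coordinates are even, hence so is
  their gcd.\<close>

definition corners :: "(int \<times> int) list" where
  "corners = [(-1,-1), (-1,1), (0,1), (0,2), (1,2), (1,3), (3,3), (3,2), (4,2), (4,1), (5,1),
     (5,0), (3,0), (3,1), (1,1), (1,-1), (2,-1), (2,-3), (1,-3), (1,-2), (0,-2), (0,-1)]"

definition pt :: "int \<times> int \<Rightarrow> real^2" where
  "pt p = vector [of_int (fst p), of_int (snd p)]"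

definition room :: "(real^2) list" where
  "room = map pt corners"

definition corner :: "nat \<Rightarrow> int \<times> int" where
  "corner i = corners ! (i mod 22)"

definition span_box :: "int \<times> int \<Rightarrow> int \<times> int \<Rightarrow> int \<times> int \<times> int \<times> int" where
  "span_box p q = (min (fst p) (fst q), max (fst p) (fst q), min (snd p) (snd q), max (snd p) (snd q))"

text \<open>A box \<open>(l, u, l', u')\<close> stands for \<open>[l, u] \<times> [l', u']\<close>.\<close>

definition in_box :: "int \<times> int \<times> int \<times> int \<Rightarrow> real^2 \<Rightarrow> bool" where
  "in_box B z = (case B of (l, u, l', u') \<Rightarrow>
     of_int l \<le> z$1 \<and> z$1 \<le> of_int u \<and> of_int l' \<le> z$2 \<and> z$2 \<le> of_int u')"

lemma pt_nth [simp]: "pt p $ 1 = of_int (fst p)" "pt p $ 2 = of_int (snd p)"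
  by (auto simp: pt_def)

lemma vec2_eq_iff: "(z::real^2) = w \<longleftrightarrow> z$1 = w$1 \<and> z$2 = w$2"
  by (auto simp: vec_eq_iff forall_2)

lemma pt_inj [simp]: "pt p = pt q \<longleftrightarrow> p = q"
  by (auto simp: vec2_eq_iff prod_eq_iff)

lemma length_corners [simp]: "length corners = 22"
  by (simp add: corners_def)

lemma length_room [simp]: "length room = 22"
  by (simp add: room_def)

lemma pvert_room: "pvert room i = pt (corner i)"
  by (simp add: pvert_def corner_def room_def)

lemma real_between_iff:
  fixes a b x :: real
  assumes "a \<noteq> b"
  shows "(\<exists>u. 0 \<le> u \<and> u \<le> 1 \<and> x = (1 - u) * a + u * b) \<longleftrightarrow> min a b \<le> x \<and> x \<le> max a b"
proof
  assume "\<exists>u. 0 \<le> u \<and> u \<le> 1 \<and> x = (1 - u) * a + u * b"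
  then have "x \<in> closed_segment a b"
    by (auto simp: in_segment)
  then show "min a b \<le> x \<and> x \<le> max a b"
    by (auto simp: closed_segment_eq_real_ivl split: if_splits)
next
  assume "min a b \<le> x \<and> x \<le> max a b"
  then have "x \<in> closed_segment a b"
    by (auto simp: closed_segment_eq_real_ivl min_def max_def split: if_splits)
  then show "\<exists>u. 0 \<le> u \<and> u \<le> 1 \<and> x = (1 - u) * a + u * b"
    by (auto simp: in_segment)
qed

text \<open>One coordinate is constant along such a segment and the other sweeps an interval. With
  edges as integer boxes, simplicity of the polygon becomes a finite integer computation.\<close>

lemma axis_segment_eq_box:
  assumes "p \<noteq> q" and "fst p = fst q \<or> snd p = snd q"
  shows "closed_segment (pt p) (pt q) = {z. in_box (span_box p q) z}"
proof -
  have same: "(1 - u) * c + u * c = c" for u c :: real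
    by (simp add: left_diff_distrib)
  have eq: "z \<in> closed_segment (pt p) (pt q) \<longleftrightarrow>
      (\<exists>u. 0 \<le> u \<and> u \<le> 1 \<and> z$1 = (1 - u) * of_int (fst p) + u * of_int (fst q) \<and>
           z$2 = (1 - u) * of_int (snd p) + u * of_int (snd q))" for z
    unfolding in_segment vec2_eq_iff by simp
  have box: "in_box (span_box p q) z \<longleftrightarrow>
      min (of_int (fst p)) (of_int (fst q)) \<le> z$1 \<and> z$1 \<le> max (of_int (fst p)) (of_int (fst q)) \<and>
      min (of_int (snd p)) (of_int (snd q)) \<le> z$2 \<and> z$2 \<le> max (of_int (snd p)) (of_int (snd q))" for z
    by (simp add: in_box_def span_box_def of_int_min of_int_max)
  consider "fst p = fst q" "snd p \<noteq> snd q" | "snd p = snd q" "fst p \<noteq> fst q"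
    using assms by (meson prod_eqI)
  then have "z \<in> closed_segment (pt p) (pt q) \<longleftrightarrow> in_box (span_box p q) z" for z
  proof cases
    case 1
    then show ?thesis
      using real_between_iff[of "of_int (snd p)" "of_int (snd q)" "z$2"]
      unfolding eq box 1(1) same min.idem max.idem of_int_eq_iff by (metis order_antisym order_refl)
  next
    case 2
    then show ?thesis
      using real_between_iff[of "of_int (fst p)" "of_int (fst q)" "z$1"]
      unfolding eq box 2(1) same min.idem max.idem of_int_eq_iff by (metis order_antisym order_refl)
  qed
  then show ?thesis by blast
qed

lemma all_less_22: "(\<forall>i<22. P i) \<longleftrightarrow> list_all P [0..<22]"
  by (auto simp: list_all_iff)

lemma corner_axis: "\<forall>i<22. corner i \<noteq> corner (Suc i) \<and>
    (fst (corner i) = fst (corner (Suc i)) \<or> snd (corner i) = snd (corner (Suc i)))"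
  unfolding all_less_22 by code_simp

definition walls :: "(int \<times> int \<times> int \<times> int) list" where
  "walls = [(-1,-1,-1,1), (-1,0,1,1), (0,0,1,2), (0,1,2,2), (1,1,2,3), (1,3,3,3), (3,3,2,3),
     (3,4,2,2), (4,4,1,2), (4,5,1,1), (5,5,0,1), (3,5,0,0), (3,3,0,1), (1,3,1,1), (1,1,-1,1),
     (1,2,-1,-1), (2,2,-3,-1), (1,2,-3,-3), (1,1,-3,-2), (0,1,-2,-2), (0,0,-2,-1), (-1,0,-1,-1)]"

lemma span_corners: "\<forall>i<22. span_box (corner i) (corner (Suc i)) = walls ! i"
  unfolding all_less_22 by code_simp

lemma pedge_room: "i < 22 \<Longrightarrow> pedge room i = {z. in_box (walls ! i) z}"
  unfolding pedge_def pvert_room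
  using axis_segment_eq_box[of "corner i" "corner (Suc i)"] corner_axis span_corners by simp

lemma length_walls: "length walls = 22"
  by (simp add: walls_def)

lemma pboundary_room: "pboundary room = {z. \<exists>B\<in>set walls. in_box B z}"
proof -
  have "set walls = (!) walls ` {..<22}"
    unfolding set_conv_nth length_walls by auto
  then show ?thesis
    unfolding pboundary_def length_room by (auto simp: pedge_room simp del: split_paired_Ex split_paired_All)
qed

definition meet :: "int \<times> int \<times> int \<times> int \<Rightarrow> int \<times> int \<times> int \<times> int \<Rightarrow> int \<times> int \<times> int \<times> int" where
  "meet B C = (case B of (l, u, l', u') \<Rightarrow> case C of (k, v, k', v') \<Rightarrow>
     (max l k, min u v, max l' k', min u' v'))"

lemma in_box_meet: "in_box B z \<and> in_box C z \<longleftrightarrow> in_box (meet B C) z"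
  by (auto simp: in_box_def meet_def split: prod.splits)

definition empty_box :: "int \<times> int \<times> int \<times> int \<Rightarrow> bool" where
  "empty_box B = (case B of (l, u, l', u') \<Rightarrow> u < l \<or> u' < l')"

lemma empty_box: "empty_box B \<Longrightarrow> \<not> in_box B z"
  by (auto simp: empty_box_def in_box_def split: prod.splits)

lemma in_box_point: "in_box (a, a, b, b) z \<longleftrightarrow> z = pt (a, b)"
  by (auto simp: in_box_def vec2_eq_iff)

text \<open>All bounds are integers, so evaluation decides every pair of edges: the common box is
  either a single point, the shared corner, or has crossed bounds.\<close>

lemma edges_meet: "\<forall>i<22. \<forall>j<22. i \<noteq> j \<longrightarrow>
    (let M = meet (walls ! i) (walls ! j) in
     if j = Suc i mod 22 then M = (fst (corner j), fst (corner j), snd (corner j), snd (corner j))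
     else if i = Suc j mod 22 then M = (fst (corner i), fst (corner i), snd (corner i), snd (corner i))
     else empty_box M)"
  unfolding all_less_22 by code_simp

lemma collinear_cross:
  fixes a b c :: "real^2"
  assumes "collinear {a, b, c}"
  shows "(b$1 - a$1) * (c$2 - b$2) = (b$2 - a$2) * (c$1 - b$1)"
proof -
  obtain u where u: "\<forall>x\<in>{a,b,c}. \<forall>y\<in>{a,b,c}. \<exists>k. x - y = k *\<^sub>R u"
    using assms unfolding collinear_def by blast
  obtain k l where "b - a = k *\<^sub>R u" "c - b = l *\<^sub>R u"
    using u by (meson insertCI)
  then have "b$1 - a$1 = k * u$1" "b$2 - a$2 = k * u$2" "c$1 - b$1 = l * u$1" "c$2 - b$2 = l * u$2"
    by (metis vector_minus_component vector_scaleR_component real_scaleR_def)+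
  then show ?thesis by simp
qed

lemma corners_turn: "\<forall>i<22.
   (fst (corner (Suc i)) - fst (corner i)) * (snd (corner (Suc (Suc i))) - snd (corner (Suc i))) \<noteq>
   (snd (corner (Suc i)) - snd (corner i)) * (fst (corner (Suc (Suc i))) - fst (corner (Suc i)))"
  unfolding all_less_22 by code_simp

lemma simple_polygon_room: "simple_polygon room"
  unfolding simple_polygon_def
proof (intro conjI allI impI)
  show "3 \<le> length room" by simp
  have "distinct corners" by code_simp
  then show "distinct room"
    by (auto simp: room_def distinct_map inj_on_def)
next
  fix i assume "i < length room"
  then have i: "i < 22" by simp
  show "\<not> collinear {pvert room i, pvert room (Suc i), pvert room (Suc (Suc i))}"
  proof
    assume "collinear {pvert room i, pvert room (Suc i), pvert room (Suc (Suc i))}"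
    from collinear_cross[OF this] have
      "real_of_int ((fst (corner (Suc i)) - fst (corner i)) * (snd (corner (Suc (Suc i))) - snd (corner (Suc i)))) =
       real_of_int ((snd (corner (Suc i)) - snd (corner i)) * (fst (corner (Suc (Suc i))) - fst (corner (Suc i))))"
      by (simp add: pvert_room)
    then show False
      using corners_turn i unfolding of_int_eq_iff by blast
  qed
next
  fix i j assume "i < length room" "j < length room" and ne: "i \<noteq> j"
  then have ij: "i < 22" "j < 22" by auto
  let ?M = "meet (walls ! i) (walls ! j)"
  have int: "pedge room i \<inter> pedge room j = {z. in_box ?M z}"
    using ij by (auto simp: pedge_room simp flip: in_box_meet)
  have pv: "pvert room k = pt (corner k)" for k by (rule pvert_room)
  have cases: "if j = Suc i mod 22 then ?M = (fst (corner j), fst (corner j), snd (corner j), snd (corner j))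
     else if i = Suc j mod 22 then ?M = (fst (corner i), fst (corner i), snd (corner i), snd (corner i))
     else empty_box ?M"
    using edges_meet[rule_format, OF ij ne] by (simp only: Let_def)
  show "pedge room i \<inter> pedge room j =
          (if j = Suc i mod length room then {pvert room j}
           else if i = Suc j mod length room then {pvert room i}
           else {})"
    unfolding int length_room pv
  proof (split if_split, intro conjI impI)
    assume "j = Suc i mod 22"
    with cases show "{z. in_box ?M z} = {pt (corner j)}"
      by (simp only: if_True in_box_point prod.collapse) simp
  next
    assume n: "j \<noteq> Suc i mod 22"
    show "{z. in_box ?M z} = (if i = Suc j mod 22 then {pt (corner i)} else {})"
    proof (cases "i = Suc j mod 22")
      case True
      with cases n have "?M = (fst (corner i), fst (corner i), snd (corner i), snd (corner i))"
        by (simp only: if_False if_True)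
      then show ?thesis
        using True by (simp add: in_box_point)
    next
      case False
      with cases n have "empty_box ?M"
        by (simp only: if_False)
      then show ?thesis
        using False empty_box by auto
    qed
  qed
qed

section \<open>The interior of the room\<close>

text \<open>Overlapping boxes, whose open versions cover the region and whose closed versions add only
  boundary points.\<close>

definition floors :: "(int \<times> int \<times> int \<times> int) list" where
  "floors = [(-1,1,-1,1), (0,1,-2,2), (0,4,1,2), (1,3,1,3), (3,4,0,2), (3,5,0,1), (0,2,-2,-1), (1,2,-3,-1)]"

definition in_open_box :: "int \<times> int \<times> int \<times> int \<Rightarrow> real^2 \<Rightarrow> bool" where
  "in_open_box B z = (case B of (l, u, l', u') \<Rightarrow>
     of_int l < z$1 \<and> z$1 < of_int u \<and> of_int l' < z$2 \<and> z$2 < of_int u')"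

lemma pboundary_coords: "z \<in> pboundary room \<longleftrightarrow> (\<exists>B\<in>set walls. in_box B z)"
  by (simp add: pboundary_room)

lemmas wall_simps = pboundary_coords walls_def in_box_def
lemmas floor_simps = floors_def in_open_box_def

lemma floor_disjoint_wall:
  assumes "\<exists>B\<in>set floors. in_open_box B z"
  shows "z \<notin> pboundary room"
  using assms by (simp add: wall_simps floor_simps) (smt (verit))

lemma closed_floor:
  assumes "\<exists>B\<in>set floors. in_box B z"
  shows "z \<in> pboundary room \<or> (\<exists>B\<in>set floors. in_open_box B z)"
  using assms by (simp add: wall_simps floor_simps) (smt (verit))

text \<open>Each alternative but the last is a zone that some axis-parallel ray leaves without
  hitting a wall. The last is a pocket shut off in all four directions, by \<open>x = 1\<close>,
  \<open>x = 3\<close>, \<open>y = 1\<close> and \<open>y = -1\<close>; it needs a bent way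
  out.\<close>

lemma outside_cases:
  assumes "z \<notin> pboundary room" "\<not> (\<exists>B\<in>set floors. in_open_box B z)"
  shows "z$1 < -1 \<or> z$1 > 5 \<or> z$2 > 3 \<or> z$2 < -3 \<or> (z$1 < 0 \<and> z$2 > 1) \<or> (z$1 < 1 \<and> z$2 > 2) \<or>
    (z$1 > 3 \<and> z$2 > 2) \<or> (z$1 > 4 \<and> z$2 > 1) \<or> (2 < z$1 \<and> z$1 < 3 \<and> z$2 < 1) \<or> (z$1 > 2 \<and> z$2 < 0) \<or>
    (z$1 > 1 \<and> -1 < z$2 \<and> z$2 < 0) \<or> (z$1 < 0 \<and> z$2 < -1) \<or> (z$1 < 1 \<and> z$2 < -2) \<or>
    (1 < z$1 \<and> z$1 \<le> 2 \<and> 0 \<le> z$2 \<and> z$2 < 1)"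
  using assms by (simp add: wall_simps floor_simps) (smt (verit))

section \<open>Ways out of the complement of the region\<close>

lemma not_inside_if_unbounded:
  assumes "connected C" "C \<inter> S = {}" "\<not> bounded C" "z \<in> C"
  shows "z \<notin> inside S"
proof
  assume "z \<in> inside S"
  then have "bounded (connected_component_set (- S) z)"
    by (simp add: inside_def)
  moreover have "C \<subseteq> connected_component_set (- S) z"
    using assms by (intro connected_component_maximal) auto
  ultimately show False
    using assms(3) bounded_subset by blast
qed

lemma not_inside_if_ray:
  fixes z d :: "'a::real_normed_vector"
  assumes "d \<noteq> 0" and "\<And>t. t \<ge> 0 \<Longrightarrow> z + t *\<^sub>R d \<notin> S"
  shows "z \<notin> inside S"
proof (rule not_inside_if_unbounded)
  let ?C = "(\<lambda>t. z + t *\<^sub>R d) ` {0..}"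
  show "connected ?C"
    by (intro connected_continuous_image continuous_intros) auto
  show "?C \<inter> S = {}" using assms(2) by auto
  show "z \<in> ?C" by (rule image_eqI[of _ _ 0]) auto
  show "\<not> bounded ?C"
  proof
    assume "bounded ?C"
    then obtain M where M: "\<And>t. t \<ge> 0 \<Longrightarrow> norm (z + t *\<^sub>R d) \<le> M"
      by (auto simp: bounded_iff)
    define t where "t = (\<bar>M\<bar> + norm z + 1) / norm d"
    have "t \<ge> 0" "t * norm d = \<bar>M\<bar> + norm z + 1"
      using assms(1) by (auto simp: t_def)
    then have "norm (t *\<^sub>R d) = \<bar>M\<bar> + norm z + 1" by simp
    moreover have "norm (t *\<^sub>R d) \<le> norm (z + t *\<^sub>R d) + norm z"
      by (metis add_diff_cancel_left' norm_triangle_ineq4)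
    ultimately show False using M[OF \<open>t \<ge> 0\<close>] by linarith
  qed
qed

lemma not_inside_if_segment:
  fixes z w :: "'a::real_normed_vector"
  assumes "closed_segment z w \<inter> S = {}" and "w \<notin> inside S"
  shows "z \<notin> inside S"
proof
  assume "z \<in> inside S"
  have "w \<in> connected_component_set (- S) z"
    using assms(1) by (simp add: connected_component_def) (meson connected_segment ends_in_segment disjoint_eq_subset_Compl)
  then have "connected_component_set (- S) w = connected_component_set (- S) z"
    using connected_component_eq by blast
  then have "w \<in> inside S"
    using \<open>z \<in> inside S\<close> assms(1) by (auto simp: inside_def)
  then show False using assms(2) by simp
qed

lemma outside_room:
  assumes nb: "z \<notin> pboundary room" and nf: "\<not> (\<exists>B\<in>set floors. in_open_box B z)"
  shows "z \<notin> inside (pboundary room)"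
proof -
  define dir :: "real \<Rightarrow> real \<Rightarrow> real^2" where "dir a b = vector [a, b]" for a b
  have dir: "dir a b $ 1 = a" "dir a b $ 2 = b" for a b
    by (auto simp: dir_def)
  have ray: "z \<notin> inside (pboundary room)"
    if "a \<noteq> 0 \<or> b \<noteq> 0" "\<And>t. t \<ge> 0 \<Longrightarrow> z + t *\<^sub>R dir a b \<notin> pboundary room" for a b z
    by (rule not_inside_if_ray[of "dir a b"]) (use that in \<open>auto simp: vec2_eq_iff dir\<close>)
  have left: "z$1 < -1 \<Longrightarrow> ?thesis"
    by (rule ray[of "-1" 0]) (simp_all add: wall_simps dir)
  have right: "z$1 > 5 \<or> z$1 > 1 \<and> -1 < z$2 \<and> z$2 < 0 \<Longrightarrow> ?thesis"
    by (rule ray[of 1 0]) (simp_all add: wall_simps dir, smt (verit))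
  have up: "z$2 > 3 \<or> z$1 < 0 \<and> z$2 > 1 \<or> z$1 < 1 \<and> z$2 > 2 \<or> z$1 > 3 \<and> z$2 > 2 \<or> z$1 > 4 \<and> z$2 > 1 \<Longrightarrow> ?thesis"
    by (rule ray[of 0 1]) (simp_all add: wall_simps dir, smt (verit))
  have down: "z$2 < -3 \<or> 2 < z$1 \<and> z$1 < 3 \<and> z$2 < 1 \<or> z$1 > 2 \<and> z$2 < 0 \<or> z$1 < 0 \<and> z$2 < -1 \<or> z$1 < 1 \<and> z$2 < -2
    \<Longrightarrow> z \<notin> inside (pboundary room)" for z
    by (rule ray[of 0 "-1"]) (simp_all add: wall_simps dir, smt (verit))
  have pocket: ?thesis if "1 < z$1" "z$1 \<le> 2" "0 \<le> z$2" "z$2 < 1"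
  proof (rule not_inside_if_segment)
    \<comment> \<open>The pocket is left sideways to abscissa 5/2, strictly between the walls on
      \<open>x = 2\<close> and \<open>x = 3\<close>, from where the way down is free.\<close>
    let ?w = "dir (5/2) (z$2)"
    show "?w \<notin> inside (pboundary room)"
      by (rule down) (use that in \<open>simp add: dir\<close>)
    have "v$2 = z$2 \<and> 1 < v$1 \<and> v$1 < 3" if v: "v \<in> closed_segment z ?w" for v
    proof -
      obtain u where u: "0 \<le> u" "u \<le> 1" "v = (1 - u) *\<^sub>R z + u *\<^sub>R ?w"
        using v by (auto simp: in_segment)
      have "v$2 = (1 - u) * z$2 + u * z$2" using u(3) by (simp add: dir)
      then have "v$2 = z$2" by (simp add: left_diff_distrib)
      moreover have "v$1 \<in> closed_segment (z$1) (5/2)"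
        using u by (auto simp: in_segment dir)
      ultimately show ?thesis
        using \<open>1 < z$1\<close> \<open>z$1 \<le> 2\<close> by (auto simp: closed_segment_eq_real_ivl)
    qed
    moreover have "v \<notin> pboundary room" if "0 \<le> v$2" "v$2 < 1" "1 < v$1" "v$1 < 3" for v
      using that by (simp add: wall_simps)
    ultimately show "closed_segment z ?w \<inter> pboundary room = {}"
      using \<open>0 \<le> z$2\<close> \<open>z$2 < 1\<close> by (metis disjoint_iff)
  qed
  show ?thesis
    using outside_cases[OF nb nf] left right up down[of z] pocket by blast
qed

lemma open_floor: "open {z. \<exists>B\<in>set floors. in_open_box B z}"
  unfolding floor_simps
  by (simp, intro open_Collect_disj open_Collect_conj open_Collect_less continuous_intros)

lemma closed_floor_set: "closed {z. \<exists>B\<in>set floors. in_box B z}"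
  unfolding floors_def in_box_def
  by (simp, intro closed_Collect_disj closed_Collect_conj closed_Collect_le continuous_intros)

lemma in_open_box_imp_in_box: "in_open_box B z \<Longrightarrow> in_box B z"
  by (auto simp: in_open_box_def in_box_def split: prod.splits)

lemma bounded_floor: "bounded {z. \<exists>B\<in>set floors. in_open_box B z}"
proof (rule bounded_subset)
  show "bounded (cbox (pt (-3,-3)) (pt (5,5)))" by simp
  show "{z. \<exists>B\<in>set floors. in_open_box B z} \<subseteq> cbox (pt (-3,-3)) (pt (5,5))"
    by (auto simp: floor_simps mem_box_cart forall_2)
qed

text \<open>Off the boundary, the open boxes and the complement of the closed boxes are disjoint
  open sets that cover everything. A component that starts in an open box therefore stays in the
  open boxes and is bounded.\<close>

theorem pregion_room: "z \<in> pregion room \<longleftrightarrow> (\<exists>B\<in>set floors. in_open_box B z)"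
proof
  assume "z \<in> pregion room"
  then have "z \<in> inside (pboundary room)" "z \<notin> pboundary room"
    by (auto simp: pregion_def inside_def)
  then show "\<exists>B\<in>set floors. in_open_box B z"
    using outside_room by blast
next
  let ?U = "{z. \<exists>B\<in>set floors. in_open_box B z}" and ?K = "{z. \<exists>B\<in>set floors. in_box B z}"
  assume z: "\<exists>B\<in>set floors. in_open_box B z"
  let ?C = "connected_component_set (- pboundary room) z"
  have nb: "z \<notin> pboundary room"
    using floor_disjoint_wall z by blast
  have "?C \<subseteq> ?U"
  proof (rule ccontr)
    assume "\<not> ?C \<subseteq> ?U"
    moreover have "?C \<subseteq> ?U \<union> - ?K"
      using closed_floor connected_component_subset[of "- pboundary room" z] by blast
    ultimately have "?C \<inter> - ?K \<noteq> {}" by blast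
    moreover have "?U \<inter> - ?K \<inter> ?C = {}"
      using in_open_box_imp_in_box by blast
    moreover have "z \<in> ?C" using nb by (simp add: connected_component_refl)
    ultimately show False
      using connectedD[OF connected_connected_component[of "- pboundary room" z] open_floor
          open_Compl[OF closed_floor_set]] z \<open>?C \<subseteq> ?U \<union> - ?K\<close> by blast
  qed
  then have "bounded ?C"
    using bounded_floor bounded_subset by blast
  then show "z \<in> pregion room"
    using nb by (simp add: pregion_def inside_def)
qed

section \<open>Unit squares and their labels\<close>

text \<open>A unit square is named by its lower left corner.  The squares of the staircase \<open>Q\<close> get the
  labels 0 to 4 along the chain; a mirror image, under \<open>(i, j) \<mapsto> (i, -1 - j)\<close> or
  \<open>(i, j) \<mapsto> (3 - i, j)\<close>, gets the label of its original.  Consecutive squares of \<open>Q\<close> are adjacent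
  across a vertical line with even abscissa, a horizontal line with odd ordinate, a vertical line with
  odd abscissa and a horizontal line with even ordinate, in this order; every other side of a square
  of \<open>Q\<close> is a mirror.  Hence meeting a grid line permutes the labels by a transposition that depends
  only on the direction and the parity of the line.\<close>

definition cells :: "((int \<times> int) \<times> nat) list" where
  "cells =
    [((-1,0),0), ((0,0),1), ((0,1),2), ((1,1),3), ((1,2),4),
     ((-1,-1),0), ((0,-1),1), ((0,-2),2), ((1,-2),3), ((1,-3),4),
     ((4,0),0), ((3,0),1), ((3,1),2), ((2,1),3), ((2,2),4)]"

definition label :: "int \<Rightarrow> int \<Rightarrow> nat option" where
  "label i j = map_of cells (i, j)"

definition swap :: "nat \<Rightarrow> nat \<Rightarrow> nat \<Rightarrow> nat" where
  "swap a b s = (if s = a then b else if s = b then a else s)"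

definition cross1 :: "int \<Rightarrow> nat \<Rightarrow> nat" where
  "cross1 k = (if even k then swap 0 1 else swap 2 3)"

definition cross2 :: "int \<Rightarrow> nat \<Rightarrow> nat" where
  "cross2 k = (if even k then swap 3 4 else swap 1 2)"

lemma cross_involution [simp]: "cross1 k (cross1 k s) = s" "cross2 k (cross2 k s) = s"
  by (auto simp: cross1_def cross2_def swap_def)

lemma cross_cong: "even (k - l) \<Longrightarrow> cross1 k = cross1 l" "even (k - l) \<Longrightarrow> cross2 k = cross2 l"
  by (auto simp: cross1_def cross2_def)

lemma label_SomeD: "label i j = Some s \<Longrightarrow> ((i, j), s) \<in> set cells"
  by (auto simp: label_def dest: map_of_SomeD)

text \<open>On the left only a missing neighbour is checked: if the left neighbour is a square of
  the room, the pair is covered by the check to the right of that neighbour.\<close>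

lemma cells_cross1: "list_all (\<lambda>((i, j), s).
     (case label (i + 1) j of None \<Rightarrow> cross1 (i + 1) s = s | Some s' \<Rightarrow> s' = cross1 (i + 1) s) \<and>
     (label (i - 1) j = None \<longrightarrow> cross1 i s = s)) cells"
  by code_simp

lemma cells_cross2: "list_all (\<lambda>((i, j), s).
     (case label i (j + 1) of None \<Rightarrow> cross2 (j + 1) s = s | Some s' \<Rightarrow> s' = cross2 (j + 1) s) \<and>
     (label i (j - 1) = None \<longrightarrow> cross2 j s = s)) cells"
  by code_simp

lemma label_cross1:
  "label (k - 1) j = Some s \<Longrightarrow> label k j = Some s' \<Longrightarrow> s' = cross1 k s"
  "label (k - 1) j = Some s \<Longrightarrow> label k j = None \<Longrightarrow> cross1 k s = s"
  "label (k - 1) j = None \<Longrightarrow> label k j = Some s \<Longrightarrow> cross1 k s = s"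
  using cells_cross1 by (force dest: label_SomeD simp: list_all_iff)+

lemma label_cross2:
  "label i (k - 1) = Some s \<Longrightarrow> label i k = Some s' \<Longrightarrow> s' = cross2 k s"
  "label i (k - 1) = Some s \<Longrightarrow> label i k = None \<Longrightarrow> cross2 k s = s"
  "label i (k - 1) = None \<Longrightarrow> label i k = Some s \<Longrightarrow> cross2 k s = s"
  using cells_cross2 by (force dest: label_SomeD simp: list_all_iff)+

text \<open>The places allowed strictly between the ends of a path. Open edges leave out precisely
  the corners of the room, where a path would stop.\<close>

definition admissible :: "real^2 \<Rightarrow> bool" where
  "admissible z \<longleftrightarrow> z \<in> pregion room \<or> (\<exists>i<22. z \<in> open_segment (pt (corner i)) (pt (corner (Suc i))))"

lemma open_wall:
  assumes "i < 22" "z \<in> open_segment (pt (corner i)) (pt (corner (Suc i)))"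
  shows "in_box (walls ! i) z" "z \<noteq> pt (corner i)" "z \<noteq> pt (corner (Suc i))"
  using assms pedge_room[of i] by (auto simp: open_segment_def pedge_def pvert_room)

lemma walls_degenerate: "list_all (\<lambda>(l, u, l', u'). l = u \<or> l' = u') walls"
  by code_simp

lemma walls_flank: "list_all (\<lambda>(l, u, l', u').
     (l = u \<longrightarrow> list_all (\<lambda>j. label (l - 1) j = None \<or> label l j = None) [l'..u'-1]) \<and>
     (l' = u' \<longrightarrow> list_all (\<lambda>i. label i (l' - 1) = None \<or> label i l' = None) [l..u-1])) walls"
  by code_simp

lemma wall_mem: "i < 22 \<Longrightarrow> walls ! i \<in> set walls"
  by (simp add: length_walls)

lemma wall_integer:
  assumes "B \<in> set walls" "in_box B z"
  shows "z$1 \<in> \<int> \<or> z$2 \<in> \<int>"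
proof -
  obtain l u l' u' where B: "B = (l, u, l', u')" by (cases B) auto
  have "l = u \<or> l' = u'" using walls_degenerate assms(1) B by (auto simp: list_all_iff)
  then have "z$1 = of_int l \<or> z$2 = of_int l'" using assms(2) B by (auto simp: in_box_def)
  then show ?thesis by auto
qed

lemma floors_cells: "list_all (\<lambda>(l, u, l', u'). list_all (\<lambda>i. list_all (\<lambda>j. label i j \<noteq> None) [l'..u'-1]) [l..u-1]) floors"
  by code_simp

text \<open>Walls lie on grid lines, so off the grid an admissible point is in the open region, and
  the boxes of \<open>floors\<close> consist of labelled squares.\<close>

lemma label_exists:
  assumes "admissible z" "z$1 \<notin> \<int>" "z$2 \<notin> \<int>"
  shows "\<exists>s. label \<lfloor>z$1\<rfloor> \<lfloor>z$2\<rfloor> = Some s"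
proof -
  have "z \<in> pregion room"
    using assms open_wall(1) wall_mem wall_integer unfolding admissible_def by blast
  then obtain l u l' u' where B: "(l, u, l', u') \<in> set floors" "in_open_box (l, u, l', u') z"
    unfolding pregion_room by auto
  then have "\<lfloor>z$1\<rfloor> \<in> set [l..u-1]" "\<lfloor>z$2\<rfloor> \<in> set [l'..u'-1]"
    by (auto simp: in_open_box_def floor_less_iff le_floor_iff)
  then show ?thesis
    using floors_cells B(1) by (fastforce simp: list_all_iff)
qed

text \<open>No unit piece of wall has squares of the room on both sides
  (\<open>walls_flank\<close>). So a path that meets a grid line between two squares of the room is
  off the walls there and goes straight on.\<close>

lemma wall_flank1:
  assumes "admissible z" "z$1 = of_int k" "z$2 \<notin> \<int>"
    and "label (k - 1) \<lfloor>z$2\<rfloor> \<noteq> None" "label k \<lfloor>z$2\<rfloor> \<noteq> None"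
  shows "z \<in> pregion room"
proof (rule ccontr)
  assume "z \<notin> pregion room"
  then obtain B where "B \<in> set walls" "in_box B z"
    using assms(1) open_wall(1) wall_mem unfolding admissible_def by blast
  then obtain l u l' u' where B: "(l, u, l', u') \<in> set walls" "in_box (l, u, l', u') z"
    by (metis prod_cases4)
  have "l' \<noteq> u'" using B(2) assms(3) by (auto simp: in_box_def) (metis Ints_of_int antisym)
  then have "l = u" using walls_degenerate B(1) by (auto simp: list_all_iff)
  then have "l = k" using B(2) assms(2) by (auto simp: in_box_def)
  \<comment> \<open>The box is closed, and its top end would have floor \<open>u'\<close>, one
    square too high; a non-integer ordinate excludes it.\<close>
  have "z$2 \<noteq> of_int u'" using assms(3) by auto
  then have "\<lfloor>z$2\<rfloor> \<in> set [l'..u'-1]"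
    using B(2) by (auto simp: in_box_def le_floor_iff) linarith
  then have "label (l - 1) \<lfloor>z$2\<rfloor> = None \<or> label l \<lfloor>z$2\<rfloor> = None"
    using walls_flank B(1) \<open>l = u\<close> by (fastforce simp: list_all_iff)
  then show False using assms(4,5) \<open>l = k\<close> by auto
qed

lemma wall_flank2:
  assumes "admissible z" "z$2 = of_int k" "z$1 \<notin> \<int>"
    and "label \<lfloor>z$1\<rfloor> (k - 1) \<noteq> None" "label \<lfloor>z$1\<rfloor> k \<noteq> None"
  shows "z \<in> pregion room"
proof (rule ccontr)
  assume "z \<notin> pregion room"
  then obtain B where "B \<in> set walls" "in_box B z"
    using assms(1) open_wall(1) wall_mem unfolding admissible_def by blast
  then obtain l u l' u' where B: "(l, u, l', u') \<in> set walls" "in_box (l, u, l', u') z"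
    by (metis prod_cases4)
  have "l \<noteq> u" using B(2) assms(3) by (auto simp: in_box_def) (metis Ints_of_int antisym)
  then have "l' = u'" using walls_degenerate B(1) by (auto simp: list_all_iff)
  then have "l' = k" using B(2) assms(2) by (auto simp: in_box_def)
  have "z$1 \<noteq> of_int u" using assms(3) by auto
  then have "\<lfloor>z$1\<rfloor> \<in> set [l..u-1]"
    using B(2) by (auto simp: in_box_def le_floor_iff) linarith
  then have "label \<lfloor>z$1\<rfloor> (l' - 1) = None \<or> label \<lfloor>z$1\<rfloor> l' = None"
    using walls_flank B(1) \<open>l' = u'\<close> by (fastforce simp: list_all_iff)
  then show False using assms(4,5) \<open>l' = k\<close> by auto
qed

text \<open>The integer points of the closed region that are not corners of the room.\<close>

definition lattice_points :: "(int \<times> int) list" where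
  "lattice_points = [(0,0), (2,2), (-1,0), (1,0), (2,1), (2,3), (2,-2), (4,0)]"

lemma floors_lattice: "list_all (\<lambda>(l, u, l', u').
    list_all (\<lambda>i. list_all (\<lambda>j. (i, j) \<in> set lattice_points) [l'+1..u'-1]) [l+1..u-1]) floors"
  by code_simp

lemma walls_lattice: "list_all (\<lambda>n. case walls ! n of (l, u, l', u') \<Rightarrow>
    list_all (\<lambda>i. list_all (\<lambda>j. (i, j) = corner n \<or> (i, j) = corner (Suc n) \<or>
      (i, j) \<in> set lattice_points) [l'..u']) [l..u]) [0..<22]"
  by code_simp

lemma admissible_lattice:
  assumes "admissible (pt (k, l))"
  shows "(k, l) \<in> set lattice_points"
  using assms unfolding admissible_def
proof
  assume "pt (k, l) \<in> pregion room"
  then obtain a b c d where B: "(a, b, c, d) \<in> set floors" "in_open_box (a, b, c, d) (pt (k, l))"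
    unfolding pregion_room by auto
  then have "k \<in> set [a+1..b-1]" "l \<in> set [c+1..d-1]"
    by (auto simp: in_open_box_def)
  then show ?thesis
    using floors_lattice B(1) by (fastforce simp: list_all_iff)
next
  assume "\<exists>i<22. pt (k, l) \<in> open_segment (pt (corner i)) (pt (corner (Suc i)))"
  then obtain i where i: "i < 22" "in_box (walls ! i) (pt (k, l))"
      "(k, l) \<noteq> corner i" "(k, l) \<noteq> corner (Suc i)"
    using open_wall by (metis pt_inj)
  obtain a b c d where B: "walls ! i = (a, b, c, d)" by (cases "walls ! i") auto
  then have "k \<in> set [a..b]" "l \<in> set [c..d]"
    using i(2) by (auto simp: in_box_def)
  then show ?thesis
    using walls_lattice i B by (fastforce simp: list_all_iff)
qed


text \<open>The odd points are (-1,0), (1,0), (2,1) and (2,3), right-angled corners of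
  \<open>Q\<close> on the mirror lines. One square of \<open>Q\<close> touches each, and the squares
  of the room around it are that square and its image.\<close>

lemma lattice_odd_check: "list_all (\<lambda>(k, l). even k \<and> even l \<or>
    (\<exists>s\<in>set [0,1,2,3,4]. list_all (\<lambda>i. list_all (\<lambda>j. label i j = None \<or> label i j = Some s) [l-1,l]) [k-1,k])) lattice_points"
  by code_simp

lemma lattice_odd:
  assumes "(k, l) \<in> set lattice_points" "odd k \<or> odd l"
    and "i \<in> {k-1, k}" "j \<in> {l-1, l}" "i' \<in> {k-1, k}" "j' \<in> {l-1, l}"
    and "label i j = Some s" "label i' j' = Some s'"
  shows "s = s'"
proof -
  obtain r where "\<forall>i\<in>{k-1,k}. \<forall>j\<in>{l-1,l}. label i j = None \<or> label i j = Some r"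
    using lattice_odd_check assms(1,2) by (auto simp: list_all_iff)
  then have "label i j = Some r" "label i' j' = Some r"
    using assms(3-8) by fastforce+
  then show ?thesis using assms(7,8) by simp
qed

text \<open>The even points are (0,0) and its image (4,0), surrounded by labels 0 and 1, and (2,2)
  and its image (2,-2), surrounded by labels 3 and 4. Hence \<open>s < 2\<close> can serve as the
  test for being next to an image of the source.\<close>

lemma lattice_even_check: "list_all (\<lambda>(k, l). odd k \<or> odd l \<or>
    (\<forall>M\<in>set [[0,1],[3,4]]. list_ex (\<lambda>i. list_ex (\<lambda>j. case label i j of None \<Rightarrow> False | Some s \<Rightarrow> s \<in> set M) [l-1,l]) [k-1,k] \<longrightarrow>
    list_all (\<lambda>i. list_all (\<lambda>j. case label i j of None \<Rightarrow> True | Some s \<Rightarrow> s \<in> set M) [l-1,l]) [k-1,k])) lattice_points"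
  by code_simp

lemma lattice_even:
  assumes "(k, l) \<in> set lattice_points" "even k" "even l"
    and ij: "i \<in> {k-1, k}" "j \<in> {l-1, l}" and ij': "i' \<in> {k-1, k}" "j' \<in> {l-1, l}"
    and s: "label i j = Some s" and s': "label i' j' = Some s'" and "s < 2"
  shows "s' < 2"
proof -
  have imp: "\<forall>M\<in>set [[0,1],[3,4]]. list_ex (\<lambda>i. list_ex (\<lambda>j. case label i j of None \<Rightarrow> False | Some s \<Rightarrow> s \<in> set M) [l-1,l]) [k-1,k] \<longrightarrow>
    list_all (\<lambda>i. list_all (\<lambda>j. case label i j of None \<Rightarrow> True | Some s \<Rightarrow> s \<in> set M) [l-1,l]) [k-1,k]"
    using lattice_even_check assms(1-3) unfolding list_all_iff by blast
  have "s \<in> set [0,1]" using \<open>s < 2\<close> by auto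
  have "i \<in> set [k-1,k]" "j \<in> set [l-1,l]" "i' \<in> set [k-1,k]" "j' \<in> set [l-1,l]"
    using ij ij' by auto
  note mem = this
  have "case label i j of None \<Rightarrow> False | Some s \<Rightarrow> s \<in> set [0,1]"
    using s \<open>s \<in> set [0,1]\<close> by simp
  then have "list_ex (\<lambda>i. list_ex (\<lambda>j. case label i j of None \<Rightarrow> False | Some s \<Rightarrow> s \<in> set [0,1]) [l-1,l]) [k-1,k]"
    unfolding list_ex_iff using mem by blast
  moreover have "[0,1] \<in> set [[0,1::nat],[3,4]]" by simp
  ultimately have "list_all (\<lambda>i. list_all (\<lambda>j. case label i j of None \<Rightarrow> True | Some s \<Rightarrow> s \<in> set [0,1]) [l-1,l]) [k-1,k]"
    using imp by blast
  then have "case label i' j' of None \<Rightarrow> True | Some s \<Rightarrow> s \<in> set [0,1]"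
    unfolding list_all_iff using mem by blast
  then show ?thesis using s' by auto
qed

lemma label_near_source:
  assumes "i \<in> {-1, 0}" "j \<in> {-1, 0}" "label i j = Some s"
  shows "s < 2"
proof -
  have "label 0 0 = Some 1" by code_simp
  then show ?thesis
    using lattice_even[of 0 0 0 0 i j 1 s] assms by (simp add: lattice_points_def)
qed

lemma label_near_target:
  assumes "i \<in> {1, 2}" "j \<in> {1, 2}" "label i j = Some s"
  shows "\<not> s < 2"
proof
  assume "s < 2"
  have "label 1 1 = Some 3" by code_simp
  then show False
    using lattice_even[of 2 2 i j 1 1 s 3] assms \<open>s < 2\<close> by (simp add: lattice_points_def)
qed

section \<open>Paths in unfolded time\<close>

text \<open>One coordinate of a path whose unfolding is \<open>t \<mapsto> a t\<close>: since all mirrors are at integers, folding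
  changes the sign and adds an even integer.\<close>

definition zigzag :: "real \<Rightarrow> real \<Rightarrow> (real \<Rightarrow> real) \<Rightarrow> bool" where
  "zigzag a T x \<longleftrightarrow>
     (\<forall>s\<in>{0..T}. \<forall>t\<in>{0..T}. \<bar>x s - x t\<bar> \<le> a * \<bar>s - t\<bar>) \<and>
     (\<forall>t\<in>{0..T}. \<exists>m::int. x t = a * t + 2 * real_of_int m \<or> x t = - a * t + 2 * real_of_int m)"

text \<open>Distinguishes passing a grid line from bouncing off it, which \<open>zigzag\<close>
  leaves open: the slope \<open>e\<close> is the same on both sides of \<open>t\<close>.\<close>

definition straight :: "real \<Rightarrow> (real \<Rightarrow> real) \<Rightarrow> real \<Rightarrow> bool" where
  "straight a x t \<longleftrightarrow> (\<exists>\<delta>>0. \<exists>e. \<bar>e\<bar> = a \<and> (\<forall>s. \<bar>s\<bar> < \<delta> \<longrightarrow> x (t + s) = x t + e * s))"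

definition extend :: "real \<Rightarrow> real \<Rightarrow> (real \<Rightarrow> real) \<Rightarrow> real \<Rightarrow> real" where
  "extend T e x = (\<lambda>t. if t \<le> T then x t else x T + e * (t - T))"

lemma zigzag_linear: "zigzag \<bar>e\<bar> T (\<lambda>t. e * t)"
  unfolding zigzag_def
proof (intro conjI ballI)
  fix s t
  show "\<bar>e * s - e * t\<bar> \<le> \<bar>e\<bar> * \<bar>s - t\<bar>"
    by (simp add: abs_mult flip: right_diff_distrib)
  show "\<exists>m::int. e * t = \<bar>e\<bar> * t + 2 * real_of_int m \<or> e * t = - \<bar>e\<bar> * t + 2 * real_of_int m"
    by (rule exI[of _ 0]) (simp add: abs_if)
qed

lemma straight_linear: "straight \<bar>e\<bar> (\<lambda>t. e * t) t"
  unfolding straight_def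
  by (rule exI[of _ 1], simp, rule exI[of _ e]) (simp add: algebra_simps)

text \<open>By the last assumption the new leg \<open>x T + e * (t - T)\<close> equals
  \<open>e * t + 2 * m\<close>, so it is again plus or minus \<open>a * t\<close> up to an even
  integer.\<close>

lemma zigzag_extend:
  assumes z: "zigzag a T x" and "T \<ge> 0" and e: "\<bar>e\<bar> = a" and m: "x T = e * T + 2 * real_of_int m"
  shows "zigzag a U (extend T e x)"
  unfolding zigzag_def
proof (intro conjI ballI)
  have lip: "\<bar>x s - x t\<bar> \<le> a * \<bar>s - t\<bar>" if "s \<in> {0..T}" "t \<in> {0..T}" for s t
    using z that by (simp add: zigzag_def)
  have mixed: "\<bar>extend T e x s - extend T e x t\<bar> \<le> a * \<bar>s - t\<bar>" if "0 \<le> s" "s \<le> T" "T < t" for s t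
  proof -
    have "\<bar>x s - (x T + e * (t - T))\<bar> \<le> \<bar>x s - x T\<bar> + \<bar>e * (t - T)\<bar>"
      by linarith
    also have "\<dots> \<le> a * (T - s) + a * (t - T)"
      using lip[of s T] that e by (simp add: abs_mult)
    also have "\<dots> = a * \<bar>s - t\<bar>"
      using that by (simp add: algebra_simps)
    finally show ?thesis using that by (simp add: extend_def)
  qed
  fix s t assume "s \<in> {0..U}" "t \<in> {0..U}"
  then consider "s \<le> T" "t \<le> T" | "s \<le> T" "T < t" | "t \<le> T" "T < s" | "T < s" "T < t"
    by linarith
  then show "\<bar>extend T e x s - extend T e x t\<bar> \<le> a * \<bar>s - t\<bar>"
  proof cases
    case 1
    then show ?thesis using lip[of s t] \<open>s \<in> _\<close> \<open>t \<in> _\<close> by (simp add: extend_def)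
  next
    case 2
    then show ?thesis using mixed[of s t] \<open>s \<in> _\<close> by simp
  next
    case 3
    then show ?thesis using mixed[of t s] \<open>t \<in> _\<close> by (simp add: abs_minus_commute)
  next
    case 4
    have "e * (s - T) - e * (t - T) = e * (s - t)" by (simp add: algebra_simps)
    then have "\<bar>e * (s - T) - e * (t - T)\<bar> = a * \<bar>s - t\<bar>" using e by (simp add: abs_mult)
    then show ?thesis using 4 by (simp add: extend_def)
  qed
next
  fix t assume t: "t \<in> {0..U}"
  show "\<exists>m::int. extend T e x t = a * t + 2 * real_of_int m \<or> extend T e x t = - a * t + 2 * real_of_int m"
  proof (cases "t \<le> T")
    case True
    then show ?thesis using z t by (simp add: zigzag_def extend_def)
  next
    case False
    then have "extend T e x t = e * t + 2 * real_of_int m"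
      using m by (simp add: extend_def algebra_simps)
    moreover have "e = a \<or> e = - a" using e by linarith
    ultimately show ?thesis by metis
  qed
qed

lemma straight_extend_before:
  assumes "straight a x t" "t < T"
  shows "straight a (extend T e x) t"
proof -
  obtain d r where d: "d > 0" "\<bar>r\<bar> = a" "\<And>s. \<bar>s\<bar> < d \<Longrightarrow> x (t + s) = x t + r * s"
    using assms(1) by (auto simp: straight_def)
  then show ?thesis
    using assms(2) unfolding straight_def extend_def
    by (intro exI[of _ "min d (T - t)"] conjI exI[of _ r]) auto
qed

lemma straight_extend_after:
  assumes "\<bar>e\<bar> = a" "T < t"
  shows "straight a (extend T e x) t"
  using assms unfolding straight_def extend_def
  by (intro exI[of _ "t - T"] conjI exI[of _ e]) (auto simp: algebra_simps)

text \<open>The coordinates have constant speeds \<open>a\<close> and \<open>b\<close>, so the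
  unfolded path is at \<open>(a t, b t)\<close> at time \<open>t\<close>. Straightness is demanded
  in the open region only, since at a wall one coordinate turns.\<close>

definition traj :: "real \<Rightarrow> real \<Rightarrow> real \<Rightarrow> (real \<Rightarrow> real) \<Rightarrow> (real \<Rightarrow> real) \<Rightarrow> bool" where
  "traj a b T x y \<longleftrightarrow> T > 0 \<and> zigzag a T x \<and> zigzag b T y \<and> x 0 = 0 \<and> y 0 = 0 \<and>
     (\<forall>t. 0 < t \<and> t < T \<longrightarrow> admissible (vector [x t, y t]) \<and>
        (vector [x t, y t] \<in> pregion room \<longrightarrow> straight a x t \<and> straight b y t))"

section \<open>From billiard paths to trajectories in unfolded time\<close>

lemma inner_real2: "(u::real^2) \<bullet> v = u$1 * v$1 + u$2 * v$2"
  by (simp add: inner_vec_def sum_2)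

text \<open>All edges are parallel to an axis and lie on integer lines. So a reflection negates one
  component of the direction, and this happens where that very coordinate is an integer;
  \<open>c\<close> only adjusts the length.\<close>

lemma reflects_room:
  assumes "reflects_at room p q r"
  shows "\<exists>i<22. q \<in> open_segment (pt (corner i)) (pt (corner (Suc i)))"
    and "\<exists>c>0. (q$1 \<in> \<int> \<and> r$1 - q$1 = - c * (q$1 - p$1) \<and> r$2 - q$2 = c * (q$2 - p$2)) \<or>
      (q$2 \<in> \<int> \<and> r$1 - q$1 = c * (q$1 - p$1) \<and> r$2 - q$2 = - c * (q$2 - p$2))"
proof -
  obtain i c where i: "i < 22" and q: "q \<in> open_segment (pt (corner i)) (pt (corner (Suc i)))"
    and c: "c > 0" and r: "r - q = c *\<^sub>R reflect_dir (pt (corner (Suc i)) - pt (corner i)) (q - p)"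
    using assms by (auto simp: reflects_at_def pvert_room)
  then show "\<exists>i<22. q \<in> open_segment (pt (corner i)) (pt (corner (Suc i)))" by blast
  have box: "in_box (span_box (corner i) (corner (Suc i))) q"
    using open_wall(1)[OF i q] span_corners i by simp
  have ne: "corner i \<noteq> corner (Suc i)" and ax: "fst (corner i) = fst (corner (Suc i)) \<or> snd (corner i) = snd (corner (Suc i))"
    using corner_axis i by auto
  define d where "d = pt (corner (Suc i)) - pt (corner i)"
  have r1: "r$1 - q$1 = c * reflect_dir d (q - p) $ 1" and r2: "r$2 - q$2 = c * reflect_dir d (q - p) $ 2"
    using r by (metis d_def vector_minus_component vector_scaleR_component real_scaleR_def)+
  show "\<exists>c>0. (q$1 \<in> \<int> \<and> r$1 - q$1 = - c * (q$1 - p$1) \<and> r$2 - q$2 = c * (q$2 - p$2)) \<or>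
      (q$2 \<in> \<int> \<and> r$1 - q$1 = c * (q$1 - p$1) \<and> r$2 - q$2 = - c * (q$2 - p$2))"
  proof (cases "fst (corner i) = fst (corner (Suc i))")
    case True
    then have "snd (corner i) \<noteq> snd (corner (Suc i))" using ne by (auto simp: prod_eq_iff)
    then have d: "d$1 = 0" "d$2 \<noteq> 0" using True by (auto simp: d_def)
    have "q$1 = of_int (fst (corner i))"
      using box True by (simp add: in_box_def span_box_def)
    moreover have refl: "reflect_dir d (q - p) $ 1 = - (q$1 - p$1)" "reflect_dir d (q - p) $ 2 = q$2 - p$2"
      using d by (simp_all add: reflect_dir_def inner_real2 divide_simps)
    have "r$1 - q$1 = - c * (q$1 - p$1)" "r$2 - q$2 = c * (q$2 - p$2)"
      by (simp_all only: r1 r2 refl mult_minus_left mult_minus_right)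
    ultimately show ?thesis
      using c by (metis Ints_of_int)
  next
    case False
    then have eq: "snd (corner i) = snd (corner (Suc i))" using ax by simp
    then have d: "d$2 = 0" "d$1 \<noteq> 0" using False by (auto simp: d_def)
    have "q$2 = of_int (snd (corner i))"
      using box eq by (simp add: in_box_def span_box_def)
    moreover have refl: "reflect_dir d (q - p) $ 1 = q$1 - p$1" "reflect_dir d (q - p) $ 2 = - (q$2 - p$2)"
      using d by (simp_all add: reflect_dir_def inner_real2 divide_simps)
    have "r$1 - q$1 = c * (q$1 - p$1)" "r$2 - q$2 = - c * (q$2 - p$2)"
      by (simp_all only: r1 r2 refl mult_minus_left mult_minus_right)
    ultimately show ?thesis
      using c by (metis Ints_of_int)
  qed
qed

lemma open_wall_not_region:
  assumes "i < 22" "q \<in> open_segment (pt (corner i)) (pt (corner (Suc i)))"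
  shows "q \<notin> pregion room"
proof -
  have "q \<in> pboundary room"
    using open_wall(1)[OF assms] wall_mem[OF assms(1)] pboundary_coords by blast
  then show ?thesis by (auto simp: pregion_def inside_def)
qed

lemma vector2_eta: "vector [z$1, z$2] = (z::real^2)"
  by (simp add: vec2_eq_iff)

lemma open_segment_param:
  assumes "0 < t" "t < (L::real)" and "p \<noteq> q" and "q$1 - p$1 = L * e" "q$2 - p$2 = L * f"
  shows "vector [p$1 + e * t, p$2 + f * t] \<in> open_segment p (q::real^2)"
proof -
  have "(vector [p$1 + e * t, p$2 + f * t] :: real^2) = (1 - t / L) *\<^sub>R p + (t / L) *\<^sub>R q"
  proof -
    have "q$1 = p$1 + L * e" "q$2 = p$2 + L * f" using assms(4,5) by auto
    then show ?thesis using assms(1,2) by (simp add: vec2_eq_iff field_simps)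
  qed
  then show ?thesis
    unfolding in_segment using assms(1-3) by (intro conjI exI[of _ "t / L"]) auto
qed

text \<open>Flipping the sign of \<open>e\<close> at a bounce changes the offset from
  \<open>m\<close> to \<open>x - m\<close>, which is an integer because the wall is at an
  integer.\<close>

lemma even_shift:
  assumes "(x::real) = e * T + 2 * real_of_int m" "x \<in> \<int>"
  shows "\<exists>m'::int. x = - e * T + 2 * real_of_int m'"
proof -
  obtain k :: int where "x = of_int k" using assms(2) by (auto elim: Ints_cases)
  then have "x = - e * T + 2 * real_of_int (k - m)" using assms(1) by simp
  then show ?thesis by blast
qed

lemma traj_extend:
  assumes tr: "traj a b T x y" and e: "\<bar>e\<bar> = a" "\<bar>f\<bar> = b"
    and m: "x T = e * T + 2 * real_of_int m" "y T = f * T + 2 * real_of_int n"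
    and wall: "i < 22" "vector [x T, y T] \<in> open_segment (pt (corner i)) (pt (corner (Suc i)))"
    and L: "L > 0" and seg: "\<And>t. 0 < t \<Longrightarrow> t < L \<Longrightarrow> vector [x T + e * t, y T + f * t] \<in> pregion room"
  shows "traj a b (T + L) (extend T e x) (extend T f y)"
  unfolding traj_def
proof (intro conjI allI impI)
  have T: "T > 0" using tr by (simp add: traj_def)
  then show "T + L > 0" using L by simp
  show "zigzag a (T + L) (extend T e x)" "zigzag b (T + L) (extend T f y)"
    using tr T e m by (auto simp: traj_def intro!: zigzag_extend)
  show "extend T e x 0 = 0" "extend T f y 0 = 0"
    using tr T by (auto simp: traj_def extend_def)
  fix t assume t: "0 < t \<and> t < T + L"
  let ?z = "vector [extend T e x t, extend T f y t] :: real^2"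
  have "admissible ?z \<and> (?z \<in> pregion room \<longrightarrow>
      straight a (extend T e x) t \<and> straight b (extend T f y) t)"
  proof (cases t T rule: linorder_cases)
    case less
    then have "?z = vector [x t, y t]" by (simp add: extend_def)
    then show ?thesis
      using tr t less straight_extend_before unfolding traj_def by metis
  next
    case equal
    then have "?z = vector [x T, y T]" by (simp add: extend_def)
    then show ?thesis
      using wall open_wall_not_region unfolding admissible_def by metis
  next
    case greater
    then have "?z = vector [x T + e * (t - T), y T + f * (t - T)]" by (simp add: extend_def)
    then have "?z \<in> pregion room"
      using seg[of "t - T"] greater t by simp
    then show ?thesis
      using straight_extend_after e greater unfolding admissible_def by metis
  qed
  then show "admissible ?z" "?z \<in> pregion room \<Longrightarrow> straight a (extend T e x) t"
    "?z \<in> pregion room \<Longrightarrow> straight b (extend T f y) t" by auto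
qed

text \<open>Induction over the legs, with time scaled so that the first leg takes one unit. Besides
  the trajectory, the signed velocity \<open>(e, f)\<close> of the last leg and its even offsets are
  carried along, as the next reflection needs them.\<close>

lemma traj_of_path:
  assumes path: "billiard_path room ps" and hd: "hd ps = pt (0, 0)"
    and k: "Suc k < length ps"
  shows "\<exists>T x y e f m n \<mu>. traj \<bar>ps ! 1 $ 1\<bar> \<bar>ps ! 1 $ 2\<bar> T x y \<and> vector [x T, y T] = ps ! Suc k \<and>
     \<bar>e\<bar> = \<bar>ps ! 1 $ 1\<bar> \<and> \<bar>f\<bar> = \<bar>ps ! 1 $ 2\<bar> \<and>
     x T = e * T + 2 * real_of_int m \<and> y T = f * T + 2 * real_of_int n \<and>
     \<mu> > 0 \<and> ps ! Suc k $ 1 - ps ! k $ 1 = \<mu> * e \<and> ps ! Suc k $ 2 - ps ! k $ 2 = \<mu> * f"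
  using k
proof (induction k)
  case 0
  let ?e = "ps ! 1 $ 1" and ?f = "ps ! 1 $ 2"
  have p0: "ps ! 0 = pt (0, 0)" using hd 0 by (metis hd_conv_nth length_0_conv not_less_zero)
  have ne: "ps ! 0 \<noteq> ps ! 1" and seg: "open_segment (ps ! 0) (ps ! 1) \<subseteq> pregion room"
    using path 0 by (auto simp: billiard_path_def)
  have in_seg: "vector [?e * t, ?f * t] \<in> pregion room" if "0 < t" "t < 1" for t
    using open_segment_param[OF that ne, of ?e ?f] seg by (auto simp: p0)
  have "traj \<bar>?e\<bar> \<bar>?f\<bar> 1 (\<lambda>t. ?e * t) (\<lambda>t. ?f * t)"
    unfolding traj_def using in_seg zigzag_linear straight_linear by (simp add: admissible_def)
  moreover have "vector [?e * 1, ?f * 1] = ps ! Suc 0"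
    by (simp add: vec2_eq_iff)
  moreover have "?e * 1 = ?e * 1 + 2 * real_of_int 0" "?f * 1 = ?f * 1 + 2 * real_of_int 0"
    "ps ! Suc 0 $ 1 - ps ! 0 $ 1 = 1 * ?e" "ps ! Suc 0 $ 2 - ps ! 0 $ 2 = 1 * ?f" "(1::real) > 0"
    by (simp_all add: p0)
  ultimately show ?case by blast
next
  case (Suc k)
  then obtain T x y e f m n \<mu> where tr: "traj \<bar>ps ! 1 $ 1\<bar> \<bar>ps ! 1 $ 2\<bar> T x y"
    and z: "vector [x T, y T] = ps ! Suc k"
    and e: "\<bar>e\<bar> = \<bar>ps ! 1 $ 1\<bar>" "\<bar>f\<bar> = \<bar>ps ! 1 $ 2\<bar>"
    and m: "x T = e * T + 2 * real_of_int m" "y T = f * T + 2 * real_of_int n"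
    and \<mu>: "\<mu> > 0" "ps ! Suc k $ 1 - ps ! k $ 1 = \<mu> * e" "ps ! Suc k $ 2 - ps ! k $ 2 = \<mu> * f"
    by (metis Suc_lessD)
  let ?q = "ps ! Suc k" and ?r = "ps ! Suc (Suc k)"
  have "reflects_at room (ps ! k) ?q ?r" and ne: "?q \<noteq> ?r" and seg: "open_segment ?q ?r \<subseteq> pregion room"
    using path Suc.prems by (auto simp: billiard_path_def dest: spec[of _ "Suc k"])
  note refl = reflects_room[OF this(1)]
  obtain i where i: "i < 22" "vector [x T, y T] \<in> open_segment (pt (corner i)) (pt (corner (Suc i)))"
    using refl(1) z by auto
  obtain c where c: "c > 0" "(?q$1 \<in> \<int> \<and> ?r$1 - ?q$1 = - c * (\<mu> * e) \<and> ?r$2 - ?q$2 = c * (\<mu> * f)) \<or>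
      (?q$2 \<in> \<int> \<and> ?r$1 - ?q$1 = c * (\<mu> * e) \<and> ?r$2 - ?q$2 = - c * (\<mu> * f))"
    using refl(2) \<mu> by metis
  have xy: "?q$1 = x T" "?q$2 = y T" using z by (metis vector_2)+
  obtain e' f' m' n' where e': "\<bar>e'\<bar> = \<bar>ps ! 1 $ 1\<bar>" "\<bar>f'\<bar> = \<bar>ps ! 1 $ 2\<bar>"
    and m': "x T = e' * T + 2 * real_of_int m'" "y T = f' * T + 2 * real_of_int n'"
    and r: "?r$1 - ?q$1 = (c * \<mu>) * e'" "?r$2 - ?q$2 = (c * \<mu>) * f'"
    using c(2)
  proof
    assume A: "?q$1 \<in> \<int> \<and> ?r$1 - ?q$1 = - c * (\<mu> * e) \<and> ?r$2 - ?q$2 = c * (\<mu> * f)"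
    then obtain m' where "x T = - e * T + 2 * real_of_int m'"
      using even_shift m(1) xy by metis
    then show ?thesis using that[of "-e" f m' n] e m A by simp
  next
    assume A: "?q$2 \<in> \<int> \<and> ?r$1 - ?q$1 = c * (\<mu> * e) \<and> ?r$2 - ?q$2 = - c * (\<mu> * f)"
    then obtain n' where "y T = - f * T + 2 * real_of_int n'"
      using even_shift m(2) xy by metis
    then show ?thesis using that[of e "-f" m n'] e m A by simp
  qed
  \<comment> \<open>The duration of the new leg at the unchanged speeds.\<close>
  let ?L = "c * \<mu>"
  have L: "?L > 0" using c(1) \<mu>(1) by simp
  have "vector [x T + e' * t, y T + f' * t] \<in> pregion room" if "0 < t" "t < ?L" for t
    using open_segment_param[OF that ne r] seg xy by auto
  from traj_extend[OF tr e' m' i L this]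
  have f1: "traj \<bar>ps ! 1 $ 1\<bar> \<bar>ps ! 1 $ 2\<bar> (T + ?L) (extend T e' x) (extend T f' y)" .
  have end1: "extend T e' x (T + ?L) = ?r$1" and end2: "extend T f' y (T + ?L) = ?r$2"
    using r L xy by (auto simp: extend_def algebra_simps)
  have f2: "vector [extend T e' x (T + ?L), extend T f' y (T + ?L)] = ?r"
    unfolding end1 end2 by (rule vector2_eta)
  have f3: "extend T e' x (T + ?L) = e' * (T + ?L) + 2 * real_of_int m'"
    "extend T f' y (T + ?L) = f' * (T + ?L) + 2 * real_of_int n'"
    unfolding end1 end2 using r m' xy by (auto simp: algebra_simps)
  show ?case
    using f1 f2 f3 e' L r by blast
qed

lemma traj_of_illuminates:
  assumes "illuminates room (pt (0, 0)) (pt (2, 2))"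
  shows "\<exists>a b T x y. a \<ge> 0 \<and> b \<ge> 0 \<and> traj a b T x y \<and> x T = 2 \<and> y T = 2"
proof -
  obtain ps where ps: "billiard_path room ps" "hd ps = pt (0, 0)" "last ps = pt (2, 2)"
    using assms by (auto simp: illuminates_def)
  then have "length ps \<ge> 2" by (simp add: billiard_path_def)
  then obtain k where len: "length ps = Suc (Suc k)"
    by (metis add_2_eq_Suc le_Suc_ex)
  then have k: "Suc k < length ps" "ps ! Suc k = pt (2, 2)"
    using ps(3) by (simp, metis diff_Suc_1 last_conv_nth list.size(3) nat.distinct(1))
  obtain T x y where "traj \<bar>ps ! 1 $ 1\<bar> \<bar>ps ! 1 $ 2\<bar> T x y" "vector [x T, y T] = pt (2, 2)"
    using traj_of_path[OF ps(1,2) k(1)] k(2) by metis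
  moreover from this(2) have "x T = 2" "y T = 2"
    by (simp_all add: vec2_eq_iff)
  ultimately show ?thesis by (metis abs_ge_zero)
qed

section \<open>Labels along a path\<close>

lemma floor_near_int:
  fixes x :: real
  assumes "\<bar>x - of_int k\<bar> < 1"
  shows "\<lfloor>x\<rfloor> \<in> {k - 1, k}"
proof -
  have "k - 1 \<le> \<lfloor>x\<rfloor>" "\<lfloor>x\<rfloor> \<le> k" using assms by linarith+
  then show ?thesis by auto
qed

lemma not_int_between:
  assumes "of_int k < (x::real)" "x < of_int k + 1"
  shows "x \<notin> \<int>" "\<lfloor>x\<rfloor> = k"
proof -
  show f: "\<lfloor>x\<rfloor> = k" using assms by (simp add: floor_eq_iff)
  show "x \<notin> \<int>"
  proof
    assume "x \<in> \<int>"
    then have "of_int \<lfloor>x\<rfloor> = x" by simp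
    then show False using f assms(1) by simp
  qed
qed

context
  fixes a T :: real and x :: "real \<Rightarrow> real"
  assumes a: "a > 0" and zig: "zigzag a T x"
begin

lemma zigzag_lipschitz: "s \<in> {0..T} \<Longrightarrow> t \<in> {0..T} \<Longrightarrow> \<bar>x s - x t\<bar> \<le> a * \<bar>s - t\<bar>"
  using zig by (simp add: zigzag_def)

text \<open>Folding preserves parity. So the parity of the grid line met in the room, and with it
  the transposition of labels, can be read off the unfolded line.\<close>

lemma zigzag_int:
  assumes "t \<in> {0..T}" "a * t = of_int n"
  shows "\<exists>k. x t = of_int k \<and> even (k - n)"
proof -
  obtain m :: int where "x t = a * t + 2 * real_of_int m \<or> x t = - a * t + 2 * real_of_int m"
    using zig assms(1) unfolding zigzag_def by blast
  then have "x t = of_int (n + 2 * m) \<or> x t = of_int (- n + 2 * m)"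
    using assms(2) by auto
  then show ?thesis
    by (elim disjE) (rule exI, rule conjI, assumption, simp)+
qed

lemma zigzag_int_iff:
  assumes "t \<in> {0..T}"
  shows "x t \<in> \<int> \<longleftrightarrow> a * t \<in> \<int>"
proof
  assume "a * t \<in> \<int>"
  then show "x t \<in> \<int>" using zigzag_int[OF assms] by (metis Ints_cases Ints_of_int)
next
  assume x: "x t \<in> \<int>"
  obtain m :: int where "x t = a * t + 2 * real_of_int m \<or> x t = - a * t + 2 * real_of_int m"
    using zig assms unfolding zigzag_def by blast
  then have "a * t = x t - of_int (2 * m) \<or> a * t = of_int (2 * m) - x t" by auto
  then show "a * t \<in> \<int>" using x by (metis Ints_diff Ints_of_int)
qed

lemma zigzag_continuous: "continuous_on {0..T} x"
proof (rule lipschitz_on_continuous_on)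
  show "a-lipschitz_on {0..T} x"
    using zigzag_lipschitz a by (auto simp: lipschitz_on_def dist_real_def)
qed

text \<open>To change its floor, the continuous \<open>x\<close> would have to take an integer value
  in between, and it is an integer only when \<open>a * t\<close> is.\<close>

lemma zigzag_floor_eq:
  assumes "0 \<le> s" "s \<le> t" "t \<le> T" "a * s \<notin> \<int>" "a * t \<notin> \<int>" and eq: "\<lfloor>a * s\<rfloor> = \<lfloor>a * t\<rfloor>"
  shows "\<lfloor>x s\<rfloor> = \<lfloor>x t\<rfloor>"
proof (rule ccontr)
  assume "\<lfloor>x s\<rfloor> \<noteq> \<lfloor>x t\<rfloor>"
  then obtain k :: int where k: "x s \<le> of_int k \<and> of_int k \<le> x t \<or> x t \<le> of_int k \<and> of_int k \<le> x s"
    by (metis floor_mono linorder_le_cases le_floor_iff of_int_floor_le order.trans order_antisym floor_le_iff less_le_not_le)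
  have cont: "continuous_on {s..t} x"
    using zigzag_continuous continuous_on_subset assms(1,3) by (metis atLeastatMost_subset_iff)
  obtain u where u: "s \<le> u" "u \<le> t" "x u = of_int k"
    using k IVT'[of x s "of_int k" t, OF _ _ assms(2) cont] IVT2'[of x t "of_int k" s, OF _ _ assms(2) cont] by blast
  then have "a * u \<in> \<int>" using zigzag_int_iff[of u] assms by auto
  moreover have "a * s \<le> a * u" "a * u \<le> a * t" using u a by auto
  moreover have "\<lfloor>a * u\<rfloor> = \<lfloor>a * s\<rfloor>"
    using floor_mono[OF \<open>a * s \<le> a * u\<close>] floor_mono[OF \<open>a * u \<le> a * t\<close>] eq by linarith
  ultimately have "a * u \<le> a * s" by (metis Ints_cases floor_of_int of_int_floor_le)
  then show False using \<open>a * s \<le> a * u\<close> \<open>a * u \<in> \<int>\<close> assms(4) by (metis order_antisym)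
qed

text \<open>Right around \<open>t\<close> the coordinate passes the integer \<open>x t\<close> with
  nonzero slope, so the floors differ there; \<open>zigzag_floor_eq\<close> carries this out to
  \<open>s1\<close> and \<open>s2\<close>.\<close>

lemma straight_floor_neq:
  assumes st: "straight a x t" and t: "a * t = of_int n"
    and s1: "0 \<le> s1" "s1 < t" "of_int n - 1 < a * s1" and s2: "t < s2" "s2 \<le> T" "a * s2 < of_int n + 1"
  shows "\<lfloor>x s1\<rfloor> \<noteq> \<lfloor>x s2\<rfloor>"
proof -
  obtain d e where d: "d > 0" "\<bar>e\<bar> = a" "\<And>s. \<bar>s\<bar> < d \<Longrightarrow> x (t + s) = x t + e * s"
    using st by (auto simp: straight_def)
  obtain k where k: "x t = of_int k"
    using zigzag_int[of t n] t s1 s2 by auto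
  obtain r where r: "0 < r" "r < d" "r \<le> t - s1" "r \<le> s2 - t"
    using that[of "min (d / 2) (min (t - s1) (s2 - t))"] d(1) s1(2) s2(1) by auto
  have ar: "a * (t - r) < of_int n" "of_int n < a * (t + r)"
    using t a r(1) by (auto simp: algebra_simps)
  have mono: "a * s1 \<le> a * (t - r)" "a * (t + r) \<le> a * s2"
    using a r by auto
  have n1: "a * s1 \<notin> \<int>" "\<lfloor>a * s1\<rfloor> = n - 1" "a * (t - r) \<notin> \<int>" "\<lfloor>a * (t - r)\<rfloor> = n - 1"
    using not_int_between[of "n - 1" "a * s1"] not_int_between[of "n - 1" "a * (t - r)"] s1 ar mono by auto
  have n2: "a * s2 \<notin> \<int>" "\<lfloor>a * s2\<rfloor> = n" "a * (t + r) \<notin> \<int>" "\<lfloor>a * (t + r)\<rfloor> = n"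
    using not_int_between[of n "a * s2"] not_int_between[of n "a * (t + r)"] s2 ar mono by auto
  have f1: "\<lfloor>x s1\<rfloor> = \<lfloor>x (t - r)\<rfloor>"
    by (rule zigzag_floor_eq) (use s1 s2 r n1 in auto)
  have f2: "\<lfloor>x (t + r)\<rfloor> = \<lfloor>x s2\<rfloor>"
    by (rule zigzag_floor_eq) (use s1 s2 r n2 in auto)
  have "x (t - r) = of_int k - e * r" "x (t + r) = of_int k + e * r"
    using d(3)[of "- r"] d(3)[of r] r k by auto
  moreover have "e * r > 0 \<or> e * r < 0" using d(2) a r(1) by (auto simp: abs_if mult_less_0_iff split: if_splits)
  ultimately have "x (t - r) < of_int k \<and> of_int k < x (t + r) \<or> x (t + r) < of_int k \<and> of_int k < x (t - r)"
    by auto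
  then have "\<lfloor>x (t - r)\<rfloor> < k \<and> k \<le> \<lfloor>x (t + r)\<rfloor> \<or> \<lfloor>x (t + r)\<rfloor> < k \<and> k \<le> \<lfloor>x (t - r)\<rfloor>"
    by (auto simp: floor_less_iff le_floor_iff)
  then show ?thesis using f1 f2 by auto
qed

lemma zigzag_floor_near:
  assumes "s \<in> {0..T}" "t \<in> {0..T}" "a * \<bar>s - t\<bar> < 1" "x t = of_int k"
  shows "\<lfloor>x s\<rfloor> \<in> {k - 1, k}"
  using floor_near_int[of "x s" k] zigzag_lipschitz[OF assms(1,2)] assms(3,4) by auto

end

lemma Ints_shift_iff:
  fixes r :: real
  shows "r + of_int k \<in> \<int> \<longleftrightarrow> r \<in> \<int>" "of_int k - r \<in> \<int> \<longleftrightarrow> r \<in> \<int>"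
proof -
  show "r + of_int k \<in> \<int> \<longleftrightarrow> r \<in> \<int>"
    by (metis Ints_add Ints_diff Ints_of_int add_diff_cancel_right')
  show "of_int k - r \<in> \<int> \<longleftrightarrow> r \<in> \<int>"
    by (metis Ints_diff Ints_of_int diff_diff_eq2 add_diff_cancel_left')
qed

lemma not_int_floor_less:
  fixes r :: real
  assumes "r \<notin> \<int>"
  shows "of_int \<lfloor>r\<rfloor> < r" "r < of_int \<lfloor>r\<rfloor> + 1"
proof -
  have "of_int \<lfloor>r\<rfloor> \<noteq> r" using assms by (metis Ints_of_int)
  then show "of_int \<lfloor>r\<rfloor> < r" "r < of_int \<lfloor>r\<rfloor> + 1" by linarith+
qed

lemma floor_int_diff:
  fixes r :: real
  assumes "r \<notin> \<int>"
  shows "\<lfloor>of_int k - r\<rfloor> = k - \<lfloor>r\<rfloor> - 1"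
  using not_int_floor_less[OF assms] by linarith

context
  fixes a b T :: real and x y :: "real \<Rightarrow> real"
  assumes a: "a > 0" and b: "b > 0" and tr: "traj a b T x y"
begin

definition lab :: "real \<Rightarrow> nat option" where
  "lab t = label \<lfloor>x t\<rfloor> \<lfloor>y t\<rfloor>"

lemma zig: "zigzag a T x" "zigzag b T y"
  using tr by (auto simp: traj_def)

lemma admissible_traj: "0 < t \<Longrightarrow> t < T \<Longrightarrow> admissible (vector [x t, y t])"
  using tr by (simp add: traj_def)

lemma straight_traj:
  "0 < t \<Longrightarrow> t < T \<Longrightarrow> vector [x t, y t] \<in> pregion room \<Longrightarrow> straight a x t \<and> straight b y t"
  using tr by (simp add: traj_def)

lemma lab_exists:
  assumes "0 < t" "t < T" "a * t \<notin> \<int>" "b * t \<notin> \<int>"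
  obtains s where "lab t = Some s"
proof -
  have "x t \<notin> \<int>" "y t \<notin> \<int>"
    using zigzag_int_iff[OF a zig(1), of t] zigzag_int_iff[OF b zig(2), of t] assms by auto
  then show ?thesis
    using label_exists[OF admissible_traj[OF assms(1,2)]] that by (auto simp: lab_def)
qed

text \<open>If a square beside the line is missing, the path stays on its side and the transposition
  fixes its label. If both squares are present, the point is in the open region, the path crosses,
  and the transposition exchanges their labels.\<close>

lemma lab_cross1:
  assumes t: "a * t = of_int n" "b * t \<notin> \<int>"
    and s1: "0 < s1" "s1 < t" "of_int n - 1 < a * s1" "b * s1 \<notin> \<int>" "\<lfloor>b * s1\<rfloor> = \<lfloor>b * t\<rfloor>"
    and s2: "t < s2" "s2 < T" "a * s2 < of_int n + 1" "b * s2 \<notin> \<int>" "\<lfloor>b * s2\<rfloor> = \<lfloor>b * t\<rfloor>"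
  shows "lab s2 = map_option (cross1 n) (lab s1)"
proof -
  define j where "j = \<lfloor>y t\<rfloor>"
  obtain k where k: "x t = of_int k" "even (k - n)"
    using zigzag_int[OF a zig(1), of t n] t s1 s2 by auto
  have cr: "cross1 k = cross1 n" using cross_cong(1)[OF k(2)] .
  have as: "a * s1 < of_int n" "of_int n < a * s2"
    using t(1) s1(2) s2(1) a by (metis mult_strict_left_mono)+
  have yt: "y t \<notin> \<int>" using zigzag_int_iff[OF b zig(2), of t] t s1 s2 by auto
  have y1: "\<lfloor>y s1\<rfloor> = j" unfolding j_def
    by (rule zigzag_floor_eq[OF b zig(2)]) (use t s1 s2 in auto)
  have y2: "\<lfloor>y s2\<rfloor> = j" unfolding j_def
    by (rule zigzag_floor_eq[OF b zig(2), symmetric]) (use t s1 s2 in auto)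
  have x1: "\<lfloor>x s1\<rfloor> \<in> {k - 1, k}"
    by (rule zigzag_floor_near[OF a zig(1), of _ t]) (use t s1 s2 as k in \<open>auto simp: abs_if algebra_simps\<close>)
  have x2: "\<lfloor>x s2\<rfloor> \<in> {k - 1, k}"
    by (rule zigzag_floor_near[OF a zig(1), of _ t]) (use t s1 s2 as k in \<open>auto simp: abs_if algebra_simps\<close>)
  have na: "a * s1 \<notin> \<int>" "a * s2 \<notin> \<int>"
    using not_int_between(1)[of "n - 1" "a * s1"] not_int_between(1)[of n "a * s2"] s1 s2 as by auto
  obtain p where p: "lab s1 = Some p" using lab_exists[of s1] s1 s2 na by auto
  obtain q where q: "lab s2 = Some q" using lab_exists[of s2] s1 s2 na by auto
  show ?thesis
  proof (cases "label (k - 1) j = None \<or> label k j = None")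
    case True
    then have "\<lfloor>x s1\<rfloor> = \<lfloor>x s2\<rfloor>"
      using p q x1 x2 y1 y2 by (auto simp: lab_def)
    then have "p = q" using p q y1 y2 by (simp add: lab_def)
    moreover have "cross1 k p = p"
      using True label_cross1(2,3) p x1 y1 by (auto simp: lab_def)
    ultimately show ?thesis using p q cr by simp
  next
    case False
    have "vector [x t, y t] \<in> pregion room"
      by (rule wall_flank1[of _ k]) (use admissible_traj[of t] s1 s2 k yt False in \<open>auto simp: j_def\<close>)
    then have "straight a x t" using straight_traj[of t] s1 s2 by auto
    then have "\<lfloor>x s1\<rfloor> \<noteq> \<lfloor>x s2\<rfloor>"
      by (rule straight_floor_neq[OF a zig(1) _ t(1)]) (use s1 s2 in auto)
    then have "\<lfloor>x s1\<rfloor> = k - 1 \<and> \<lfloor>x s2\<rfloor> = k \<or> \<lfloor>x s1\<rfloor> = k \<and> \<lfloor>x s2\<rfloor> = k - 1"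
      using x1 x2 by auto
    then have "q = cross1 k p \<or> p = cross1 k q"
      using p q y1 y2 label_cross1(1) by (auto simp: lab_def)
    then show ?thesis using p q cr by auto
  qed
qed

lemma lab_cross2:
  assumes t: "b * t = of_int n" "a * t \<notin> \<int>"
    and s1: "0 < s1" "s1 < t" "of_int n - 1 < b * s1" "a * s1 \<notin> \<int>" "\<lfloor>a * s1\<rfloor> = \<lfloor>a * t\<rfloor>"
    and s2: "t < s2" "s2 < T" "b * s2 < of_int n + 1" "a * s2 \<notin> \<int>" "\<lfloor>a * s2\<rfloor> = \<lfloor>a * t\<rfloor>"
  shows "lab s2 = map_option (cross2 n) (lab s1)"
proof -
  define j where "j = \<lfloor>x t\<rfloor>"
  obtain k where k: "y t = of_int k" "even (k - n)"
    using zigzag_int[OF b zig(2), of t n] t s1 s2 by auto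
  have cr: "cross2 k = cross2 n" using cross_cong(2)[OF k(2)] .
  have bs: "b * s1 < of_int n" "of_int n < b * s2"
    using t(1) s1(2) s2(1) b by (metis mult_strict_left_mono)+
  have xt: "x t \<notin> \<int>" using zigzag_int_iff[OF a zig(1), of t] t s1 s2 by auto
  have x1: "\<lfloor>x s1\<rfloor> = j" unfolding j_def
    by (rule zigzag_floor_eq[OF a zig(1)]) (use t s1 s2 in auto)
  have x2: "\<lfloor>x s2\<rfloor> = j" unfolding j_def
    by (rule zigzag_floor_eq[OF a zig(1), symmetric]) (use t s1 s2 in auto)
  have y1: "\<lfloor>y s1\<rfloor> \<in> {k - 1, k}"
    by (rule zigzag_floor_near[OF b zig(2), of _ t]) (use t s1 s2 bs k in \<open>auto simp: abs_if algebra_simps\<close>)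
  have y2: "\<lfloor>y s2\<rfloor> \<in> {k - 1, k}"
    by (rule zigzag_floor_near[OF b zig(2), of _ t]) (use t s1 s2 bs k in \<open>auto simp: abs_if algebra_simps\<close>)
  have nb: "b * s1 \<notin> \<int>" "b * s2 \<notin> \<int>"
    using not_int_between(1)[of "n - 1" "b * s1"] not_int_between(1)[of n "b * s2"] s1 s2 bs by auto
  obtain p where p: "lab s1 = Some p" using lab_exists[of s1] s1 s2 nb by auto
  obtain q where q: "lab s2 = Some q" using lab_exists[of s2] s1 s2 nb by auto
  show ?thesis
  proof (cases "label j (k - 1) = None \<or> label j k = None")
    case True
    then have "\<lfloor>y s1\<rfloor> = \<lfloor>y s2\<rfloor>"
      using p q x1 x2 y1 y2 by (auto simp: lab_def)
    then have "p = q" using p q x1 x2 by (simp add: lab_def)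
    moreover have "cross2 k p = p"
      using True label_cross2(2,3) p x1 y1 by (auto simp: lab_def)
    ultimately show ?thesis using p q cr by simp
  next
    case False
    have "vector [x t, y t] \<in> pregion room"
      by (rule wall_flank2[of _ k]) (use admissible_traj[of t] s1 s2 k xt False in \<open>auto simp: j_def\<close>)
    then have "straight b y t" using straight_traj[of t] s1 s2 by auto
    then have "\<lfloor>y s1\<rfloor> \<noteq> \<lfloor>y s2\<rfloor>"
      by (rule straight_floor_neq[OF b zig(2) _ t(1)]) (use s1 s2 in auto)
    then have "\<lfloor>y s1\<rfloor> = k - 1 \<and> \<lfloor>y s2\<rfloor> = k \<or> \<lfloor>y s1\<rfloor> = k \<and> \<lfloor>y s2\<rfloor> = k - 1"
      using y1 y2 by auto
    then have "q = cross2 k p \<or> p = cross2 k q"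
      using p q x1 x2 label_cross2(1) by (auto simp: lab_def)
    then show ?thesis using p q cr by auto
  qed
qed

section \<open>Lattice times, reversal, and unreachability of the target\<close>

lemma lattice_time:
  assumes "0 < t" "t < T" "a * t = of_int i" "b * t = of_int j"
  obtains k l where "x t = of_int k" "y t = of_int l" "even (k - i)" "even (l - j)"
    "(k, l) \<in> set lattice_points"
proof -
  obtain k l where kl: "x t = of_int k" "y t = of_int l" "even (k - i)" "even (l - j)"
    using zigzag_int[OF a zig(1), of t i] zigzag_int[OF b zig(2), of t j] assms by auto
  have "vector [x t, y t] = pt (k, l)" using kl by (simp add: vec2_eq_iff)
  then have "(k, l) \<in> set lattice_points"
    using admissible_traj[OF assms(1,2)] admissible_lattice by simp
  then show ?thesis using that kl by blast
qed


text \<open>The lines met at \<open>c + u\<close> and \<open>c - u\<close> unfold to abscissas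
  \<open>i + p\<close> and \<open>i - p\<close> of equal parity, so both act by the same involution.
  \<open>v\<close> and \<open>w\<close> lie on either side of this one crossing.\<close>

lemma lab_reverse_step1:
  assumes c: "a * c = of_int i" "b * c = of_int j" and R: "R \<le> c" "c + R \<le> T"
    and u: "0 < u" "a * u = of_int p" "b * u \<notin> \<int>"
    and v: "0 < v" "v < u" "of_int p - 1 < a * v" "b * v \<notin> \<int>" "\<lfloor>b * v\<rfloor> = \<lfloor>b * u\<rfloor>"
    and w: "u < w" "w < R" "a * w < of_int p + 1" "b * w \<notin> \<int>" "\<lfloor>b * w\<rfloor> = \<lfloor>b * u\<rfloor>"
    and IH: "lab (c + v) = lab (c - v)"
  shows "lab (c + w) = lab (c - w)"
proof -
  have plus: "b * (c + r) = b * r + of_int j" "a * (c + r) = a * r + of_int i" for r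
    using c by (simp_all add: algebra_simps)
  have minus: "b * (c - r) = of_int j - b * r" "a * (c - r) = of_int i - a * r" for r
    using c by (simp_all add: algebra_simps)
  have "lab (c + w) = map_option (cross1 (p + i)) (lab (c + v))"
    by (rule lab_cross1[of "c + u"]) (use u v w R in \<open>simp_all add: plus Ints_shift_iff\<close>)
  moreover have "lab (c - v) = map_option (cross1 (i - p)) (lab (c - w))"
    by (rule lab_cross1[of "c - u"]) (use u v w R in \<open>simp_all add: minus Ints_shift_iff floor_int_diff\<close>)
  moreover have "cross1 (p + i) = cross1 (i - p)"
    by (rule cross_cong) simp
  ultimately show ?thesis
    by (simp add: IH option.map_comp comp_def option.map_ident)
qed

lemma lab_reverse_step2:
  assumes c: "a * c = of_int i" "b * c = of_int j" and R: "R \<le> c" "c + R \<le> T"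
    and u: "0 < u" "b * u = of_int p" "a * u \<notin> \<int>"
    and v: "0 < v" "v < u" "of_int p - 1 < b * v" "a * v \<notin> \<int>" "\<lfloor>a * v\<rfloor> = \<lfloor>a * u\<rfloor>"
    and w: "u < w" "w < R" "b * w < of_int p + 1" "a * w \<notin> \<int>" "\<lfloor>a * w\<rfloor> = \<lfloor>a * u\<rfloor>"
    and IH: "lab (c + v) = lab (c - v)"
  shows "lab (c + w) = lab (c - w)"
proof -
  have plus: "b * (c + r) = b * r + of_int j" "a * (c + r) = a * r + of_int i" for r
    using c by (simp_all add: algebra_simps)
  have minus: "b * (c - r) = of_int j - b * r" "a * (c - r) = of_int i - a * r" for r
    using c by (simp_all add: algebra_simps)
  have "lab (c + w) = map_option (cross2 (p + j)) (lab (c + v))"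
    by (rule lab_cross2[of "c + u"]) (use u v w R in \<open>simp_all add: plus Ints_shift_iff\<close>)
  moreover have "lab (c - v) = map_option (cross2 (j - p)) (lab (c - w))"
    by (rule lab_cross2[of "c - u"]) (use u v w R in \<open>simp_all add: minus Ints_shift_iff floor_int_diff\<close>)
  moreover have "cross2 (p + j) = cross2 (j - p)"
    by (rule cross_cong) simp
  ultimately show ?thesis
    by (simp add: IH option.map_comp comp_def option.map_ident)
qed

text \<open>The unfolded line meets the same kinds of grid lines before and after a lattice point \<open>c\<close>, in
  reverse order.  As transpositions are involutions, the labels after \<open>c\<close> repeat those before \<open>c\<close>
  as soon as they agree next to \<open>c\<close>; this they do because a lattice point with an odd coordinate
  that is not a corner of the room is a right-angled corner of \<open>Q\<close>.\<close>

lemma lab_reverse: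
  assumes c: "a * c = of_int i" "b * c = of_int j" "odd i \<or> odd j" and R: "R \<le> c" "c + R \<le> T"
    and free: "\<And>u. 0 < u \<Longrightarrow> u < R \<Longrightarrow> \<not> (a * u \<in> \<int> \<and> b * u \<in> \<int>)"
    and w: "0 < w" "w < R" "a * w \<notin> \<int>" "b * w \<notin> \<int>"
  shows "lab (c + w) = lab (c - w)"
  using w
\<comment> \<open>The measure counts the grid lines that the unfolded path meets between
  \<open>c\<close> and \<open>c + w\<close>.\<close>
proof (induction "nat \<lfloor>a * w\<rfloor> + nat \<lfloor>b * w\<rfloor>" arbitrary: w rule: less_induct)
  case less
  define p q where "p = \<lfloor>a * w\<rfloor>" and "q = \<lfloor>b * w\<rfloor>"
  have pq: "p \<ge> 0" "q \<ge> 0" using less.prems a b by (auto simp: p_def q_def)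
  have pw: "of_int p < a * w" "a * w < of_int p + 1" and qw: "of_int q < b * w" "b * w < of_int q + 1"
    using not_int_floor_less[OF less.prems(3)] not_int_floor_less[OF less.prems(4)] by (simp_all add: p_def q_def)
  \<comment> \<open>Offsets from \<open>c\<close> of the last vertical and the last horizontal line
    met before \<open>w\<close>; 0 if there is none.\<close>
  define u u' where "u = p / a" and "u' = q / b"
  have u: "a * u = p" "b * u' = q" using a b by (auto simp: u_def u'_def)
  have uw: "u < w" "u' < w"
    using pw(1) qw(1) u a b by (metis mult_less_cancel_left_pos)+
  have nonneg: "u \<ge> 0" "u' \<ge> 0" using pq a b by (auto simp: u_def u'_def)
  consider "u = u'" | "u' < u" | "u < u'" by linarith
  then show ?case
  proof cases
    case 1
    \<comment> \<open>By \<open>free\<close> two lines are never met together at a positive offset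
      below \<open>R\<close>. So nothing is met after \<open>c\<close>, and both times are spent in
      squares that touch the lattice point, where \<open>lattice_odd\<close> applies.\<close>
    have "u = 0"
    proof (rule ccontr)
      assume "u \<noteq> 0"
      then have "0 < u" "u < R" using nonneg uw less.prems by auto
      moreover have "a * u \<in> \<int>" "b * u \<in> \<int>" using u 1 by auto
      ultimately show False using free by blast
    qed
    then have "p = 0" "q = 0" using u 1 by simp_all
    then have near: "a * w < 1" "b * w < 1" using pw qw by auto
    have cT: "0 < c" "c < T" using R less.prems by auto
    obtain k l where kl: "x c = of_int k" "y c = of_int l" "even (k - i)" "even (l - j)"
        "(k, l) \<in> set lattice_points"
      using lattice_time[OF cT c(1,2)] .
    have "a * (c + w) = a * w + of_int i" "a * (c - w) = of_int i - a * w"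
      "b * (c + w) = b * w + of_int j" "b * (c - w) = of_int j - b * w"
      using c by (simp_all add: algebra_simps)
    then have ints: "a * (c + w) \<notin> \<int>" "a * (c - w) \<notin> \<int>" "b * (c + w) \<notin> \<int>" "b * (c - w) \<notin> \<int>"
      using less.prems(3,4) by (simp_all add: Ints_shift_iff)
    have in_time: "0 < c + w" "c + w < T" "0 < c - w" "c - w < T"
      using R less.prems by simp_all
    obtain s where s: "lab (c + w) = Some s"
      using lab_exists[OF in_time(1,2) ints(1,3)] .
    obtain s' where s': "lab (c - w) = Some s'"
      using lab_exists[OF in_time(3,4) ints(2,4)] .
    have "\<lfloor>x (c + w)\<rfloor> \<in> {k - 1, k}" "\<lfloor>x (c - w)\<rfloor> \<in> {k - 1, k}"
      by (rule zigzag_floor_near[OF a zig(1), of _ c]; use in_time cT less.prems near kl in simp)+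
    moreover have "\<lfloor>y (c + w)\<rfloor> \<in> {l - 1, l}" "\<lfloor>y (c - w)\<rfloor> \<in> {l - 1, l}"
      by (rule zigzag_floor_near[OF b zig(2), of _ c]; use in_time cT less.prems near kl in simp)+
    moreover have "odd k \<or> odd l" using c(3) kl by auto
    ultimately have "s = s'"
      using lattice_odd[OF kl(5) _ _ _ _ _ s[unfolded lab_def] s'[unfolded lab_def]] by blast
    then show ?thesis using s s' by simp
  next
    case 2
    \<comment> \<open>The last line met is vertical. \<open>v\<close> is placed before it but after
      every earlier line, so only this crossing separates \<open>v\<close> from
      \<open>w\<close>.\<close>
    have "(p - 1) / a < u" using a by (simp add: u_def divide_strict_right_mono)
    then have "max u' ((p - 1) / a) < u" using 2 by simp
    then obtain v where v: "u' < v" "(p - 1) / a < v" "v < u"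
      using dense by (metis max_less_iff_conj)
    have u0: "0 < u" "u < R" using 2 nonneg uw less.prems by auto
    have v0: "0 < v" "v < R" using v nonneg u0 by auto
    have av: "of_int p - 1 < a * v" "a * v < of_int p"
      using v(2) a mult_strict_left_mono[OF v(3) a] u(1) by (simp_all add: pos_divide_less_eq mult.commute)
    have bv: "of_int q < b * v" "b * v < b * w" "of_int q < b * u" "b * u < b * w"
      using mult_strict_left_mono[OF v(1) b] mult_strict_left_mono[OF 2 b] mult_strict_left_mono[OF uw(1) b]
        mult_strict_left_mono[OF v(3) b] u(2) by simp_all
    have n: "a * v \<notin> \<int>" "\<lfloor>a * v\<rfloor> = p - 1" "b * v \<notin> \<int>" "\<lfloor>b * v\<rfloor> = q" "b * u \<notin> \<int>" "\<lfloor>b * u\<rfloor> = q"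
      using not_int_between[of "p - 1" "a * v"] not_int_between[of q "b * v"] not_int_between[of q "b * u"] av bv qw
      by auto
    have "p > 0" using mult_pos_pos[OF a u0(1)] u(1) by simp
    have "lab (c + v) = lab (c - v)"
    proof (rule less.hyps)
      show "nat \<lfloor>a * v\<rfloor> + nat \<lfloor>b * v\<rfloor> < nat \<lfloor>a * w\<rfloor> + nat \<lfloor>b * w\<rfloor>"
        using n \<open>p > 0\<close> by (simp flip: p_def q_def)
    qed (use v0 n in auto)
    then show ?thesis
      by (rule lab_reverse_step1[OF c(1,2) R u0(1) u(1) n(5) v0(1) v(3) av(1) n(3) _ uw(1) less.prems(2) pw(2) less.prems(4), rotated 2])
        (use n in \<open>simp_all flip: q_def\<close>)
  next
    case 3
    have "(q - 1) / b < u'" using b by (simp add: u'_def divide_strict_right_mono)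
    then have "max u ((q - 1) / b) < u'" using 3 by simp
    then obtain v where v: "u < v" "(q - 1) / b < v" "v < u'"
      using dense by (metis max_less_iff_conj)
    have u0: "0 < u'" "u' < R" using 3 nonneg uw less.prems by auto
    have v0: "0 < v" "v < R" using v nonneg u0 by auto
    have bv: "of_int q - 1 < b * v" "b * v < of_int q"
      using v(2) b mult_strict_left_mono[OF v(3) b] u(2) by (simp_all add: pos_divide_less_eq mult.commute)
    have av: "of_int p < a * v" "a * v < a * w" "of_int p < a * u'" "a * u' < a * w"
      using mult_strict_left_mono[OF v(1) a] mult_strict_left_mono[OF 3 a] mult_strict_left_mono[OF uw(2) a]
        mult_strict_left_mono[OF v(3) a] u(1) by simp_all
    have n: "b * v \<notin> \<int>" "\<lfloor>b * v\<rfloor> = q - 1" "a * v \<notin> \<int>" "\<lfloor>a * v\<rfloor> = p" "a * u' \<notin> \<int>" "\<lfloor>a * u'\<rfloor> = p"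
      using not_int_between[of "q - 1" "b * v"] not_int_between[of p "a * v"] not_int_between[of p "a * u'"] av bv pw
      by auto
    have "q > 0" using mult_pos_pos[OF b u0(1)] u(2) by simp
    have "lab (c + v) = lab (c - v)"
    proof (rule less.hyps)
      show "nat \<lfloor>a * v\<rfloor> + nat \<lfloor>b * v\<rfloor> < nat \<lfloor>a * w\<rfloor> + nat \<lfloor>b * w\<rfloor>"
        using n \<open>q > 0\<close> by (simp flip: p_def q_def)
    qed (use v0 n in auto)
    then show ?thesis
      by (rule lab_reverse_step2[OF c(1,2) R u0(1) u(2) n(5) v0(1) v(3) bv(1) n(3) _ uw(2) less.prems(2) qw(2) less.prems(3), rotated 2])
        (use n in \<open>simp_all flip: p_def\<close>)
  qed
qed


text \<open>Labels are read at a small distance \<open>w\<close> from the even multiples of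
  \<open>R\<close>. \<open>lab_reverse\<close> transports the label from just after one of them to
  just before the next, and \<open>lattice_even\<close> keeps \<open>s < 2\<close> across it; next
  to (2,2) this is impossible.\<close>

lemma target_unreachable:
  assumes xT: "x T = 2" and yT: "y T = 2"
  shows False
proof -
  have T: "T > 0" using tr by (simp add: traj_def)
  have ev: "\<exists>P::int. even P \<and> P > 0 \<and> d * T = of_int P" if dz: "d > 0" "zigzag d T z" "z T = 2" for d z
  proof -
    obtain m :: int where "2 = d * T + 2 * real_of_int m \<or> 2 = - d * T + 2 * real_of_int m"
      using dz(2,3) T unfolding zigzag_def by (metis atLeastAtMost_iff less_imp_le order_refl)
    then have "d * T = of_int (2 * (1 - m)) \<or> d * T = of_int (2 * (m - 1))" by auto
    then obtain P :: int where P: "d * T = of_int P" "even P" by (metis dvd_triv_left)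
    have "d * T > 0" using dz(1) T by simp
    then have "P > 0" unfolding P(1) by simp
    then show ?thesis using P by blast
  qed
  obtain P Q where P: "even P" "P > 0" "a * T = of_int P" and Q: "even Q" "Q > 0" "b * T = of_int Q"
    using ev[OF a zig(1) xT] ev[OF b zig(2) yT] by auto
  define g where "g = gcd P Q"
  obtain A B where AB: "P = A * g" "Q = B * g" "coprime A B"
    using gcd_coprime_exists[of P Q] P(2) unfolding g_def by auto
  have g: "g > 0" "even g" using P Q by (auto simp: g_def)
  have pos: "A > 0" "B > 0" using AB P(2) Q(2) g(1) zero_less_mult_pos2[of A g] zero_less_mult_pos2[of B g] by simp_all
  \<comment> \<open>The first positive time at which both unfolded coordinates are integers; there
    they form the primitive vector \<open>(A, B)\<close>.\<close>
  define R where "R = T / g"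
  have R: "R > 0" "g * R = T" using T g by (auto simp: R_def)
  have "1 * R \<le> g * R" using g(1) R(1) by (intro mult_right_mono) auto
  then have RT: "R \<le> T" using R(2) by simp
  have aR: "a * R = A" "b * R = B"
    using P(3) Q(3) AB g(1) by (auto simp: R_def field_simps)
  \<comment> \<open>Proportionality would give \<open>i * B = j * A\<close>, so the coprime
    \<open>A\<close> would divide \<open>i\<close> although \<open>0 < i < A\<close>.\<close>
  have free: "\<not> (a * u \<in> \<int> \<and> b * u \<in> \<int>)" if u: "0 < u" "u < R" for u
  proof
    assume "a * u \<in> \<int> \<and> b * u \<in> \<int>"
    then obtain i j where ij: "a * u = of_int i" "b * u = of_int j" by (auto elim!: Ints_cases)
    have "(a * u) * (b * R) = (b * u) * (a * R)" by simp
    then have "real_of_int (i * B) = real_of_int (j * A)" unfolding ij aR by simp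
    then have "A dvd i * B" by (simp only: of_int_eq_iff) simp
    then have "A dvd i" using AB(3) by (simp add: coprime_dvd_mult_left_iff)
    moreover have "real_of_int 0 < of_int i" "real_of_int i < of_int A"
      using ij(1) aR(1) mult_pos_pos[OF a u(1)] mult_strict_left_mono[OF u(2) a] by simp_all
    ultimately show False by (simp add: zdvd_not_zless)
  qed
  have small: "w < R" "a * w \<notin> \<int>" "b * w \<notin> \<int>" if w: "0 < w" "a * w < 1" "b * w < 1" for w
  proof -
    have "a * w < a * R" using aR pos w by simp
    then show "w < R" using a by simp
    show "a * w \<notin> \<int>" "b * w \<notin> \<int>"
      using not_int_between(1)[of 0 "a * w"] not_int_between(1)[of 0 "b * w"] w a b by auto
  qed
  have rev: "lab (real (2 * k + 2) * R - w) = lab (real (2 * k) * R + w)"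
    if k: "int (2 * k + 2) \<le> g" and w: "0 < w" "a * w < 1" "b * w < 1" for k w
  proof -
    \<comment> \<open>The odd multiple of \<open>R\<close> halfway between the two times.
      \<open>A\<close> and \<open>B\<close> are not both even, so its lattice point has an odd
      coordinate; reversal is applied at offset \<open>R - w\<close>.\<close>
    define c where "c = real (2 * k + 1) * R"
    have c: "a * c = of_int ((2 * int k + 1) * A)" "b * c = of_int ((2 * int k + 1) * B)"
      unfolding c_def mult.left_commute[of a _ R] mult.left_commute[of b _ R] aR by simp_all
    have "odd A \<or> odd B" using coprime_common_divisor[OF AB(3), of 2] by auto
    then have odd: "odd ((2 * int k + 1) * A) \<or> odd ((2 * int k + 1) * B)" by simp
    have "real_of_int (int (2 * k + 2)) \<le> real_of_int g"
      using k by (simp only: of_int_le_iff)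
    then have "real (2 * k + 2) * R \<le> g * R"
      using R(1) by (intro mult_right_mono) simp_all
    then have cR: "R \<le> c" "c + R \<le> T"
      using R by (simp_all add: c_def algebra_simps)
    have "a * (R - w) = of_int A - a * w" "b * (R - w) = of_int B - b * w"
      using aR by (simp_all add: algebra_simps)
    then have "a * (R - w) \<notin> \<int>" "b * (R - w) \<notin> \<int>"
      using small[OF w] by (simp_all add: Ints_shift_iff)
    then have "lab (c + (R - w)) = lab (c - (R - w))"
      by (intro lab_reverse[OF c odd cR free]) (use small[OF w] w in auto)
    moreover have "c + (R - w) = real (2 * k + 2) * R - w" "c - (R - w) = real (2 * k) * R + w"
      by (simp_all add: c_def algebra_simps)
    ultimately show ?thesis by simp
  qed
  have main: "\<exists>s<2. lab (real (2 * k) * R + w) = Some s"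
    if "int (2 * k) < g" "0 < w" "a * w < 1" "b * w < 1" for k w
    using that
  proof (induction k arbitrary: w)
    case 0
    have wT: "w < T" using small(1)[OF 0(2-)] RT by simp
    obtain s where s: "lab w = Some s"
      using lab_exists[OF 0(2) wT small(2,3)[OF 0(2-)]] .
    have "\<lfloor>x w\<rfloor> \<in> {0 - 1, 0}" "\<lfloor>y w\<rfloor> \<in> {0 - 1, 0}"
      using zigzag_floor_near[OF a zig(1), of w 0 0] zigzag_floor_near[OF b zig(2), of w 0 0] tr 0 wT
      by (auto simp: traj_def)
    then have "s < 2"
      using label_near_source s by (auto simp: lab_def)
    then show ?case using s by simp
  next
    case (Suc k)
    define d where "d = real (2 * k + 2) * R"
    have "2 * int k + 3 \<le> g" using Suc.prems(1) by simp
    then have "real_of_int (2 * int k + 3) \<le> real_of_int g" by (simp only: of_int_le_iff)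
    then have kg: "real (2 * k + 3) \<le> g" by simp
    then have "real (2 * k + 2) * R < g * R"
      by (intro mult_strict_right_mono R(1)) simp
    then have d: "0 < d" "d < T" using R by (simp_all add: d_def)
    have ad: "a * d = of_int ((2 * int k + 2) * A)" "b * d = of_int ((2 * int k + 2) * B)"
      unfolding d_def mult.left_commute[of a _ R] mult.left_commute[of b _ R] aR by simp_all
    obtain k' l where kl: "x d = of_int k'" "y d = of_int l" "even (k' - (2 * int k + 2) * A)"
        "even (l - (2 * int k + 2) * B)" "(k', l) \<in> set lattice_points"
      using lattice_time[OF d ad] .
    have "R \<le> d" using R(1) by (simp add: d_def algebra_simps)
    have "d + R \<le> T"
    proof -
      have "real (2 * k + 3) * R \<le> g * R"
        using kg R(1) by (intro mult_right_mono) simp_all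
      then show ?thesis using R by (simp add: d_def algebra_simps)
    qed
    then have in_time: "0 < d - w" "d - w < T" "0 < d + w" "d + w < T"
      using small(1)[OF Suc.prems(2-)] Suc.prems(2) \<open>R \<le> d\<close> by auto
    obtain s where s: "s < 2" "lab (d - w) = Some s"
      using Suc.IH[of w] Suc.prems rev[of k w] by (auto simp: d_def)
    have "a * (d + w) = a * w + of_int ((2 * int k + 2) * A)" "b * (d + w) = b * w + of_int ((2 * int k + 2) * B)"
      using ad by (simp_all add: algebra_simps)
    then have "a * (d + w) \<notin> \<int>" "b * (d + w) \<notin> \<int>"
      using small(2,3)[OF Suc.prems(2-)] by (simp_all only: Ints_shift_iff not_False_eq_True)
    then obtain s' where s': "lab (d + w) = Some s'"
      using lab_exists[OF in_time(3,4)] by blast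
    have xf: "\<lfloor>x (d + w)\<rfloor> \<in> {k' - 1, k'}" "\<lfloor>x (d - w)\<rfloor> \<in> {k' - 1, k'}"
      by (rule zigzag_floor_near[OF a zig(1), of _ d]; use in_time d Suc.prems kl in simp)+
    have yf: "\<lfloor>y (d + w)\<rfloor> \<in> {l - 1, l}" "\<lfloor>y (d - w)\<rfloor> \<in> {l - 1, l}"
      by (rule zigzag_floor_near[OF b zig(2), of _ d]; use in_time d Suc.prems kl in simp)+
    have "even k'" "even l" using kl by auto
    then have "s' < 2"
      using lattice_even[OF kl(5) _ _ xf(2) yf(2) xf(1) yf(1)] s s' by (auto simp: lab_def)
    moreover have "real (2 * Suc k) * R + w = d + w" by (simp add: d_def)
    ultimately show ?case using s' by simp
  qed
  \<comment> \<open>Any positive time with \<open>a * w < 1\<close> and \<open>b * w < 1\<close>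
    would do.\<close>
  define w where "w = 1 / (a + b + 1)"
  have w: "0 < w" "a * w < 1" "b * w < 1" using a b by (auto simp: w_def)
  obtain k where k: "int (2 * k + 2) = g"
  proof -
    obtain h where "g = 2 * h" using g(2) by blast
    then have "int (2 * nat (h - 1) + 2) = g" using g(1) by simp
    then show ?thesis using that by blast
  qed
  have kR: "real (2 * k + 2) * R = T" using R(2) unfolding k[symmetric] by simp
  obtain s where s: "s < 2" "lab (T - w) = Some s"
    using main[of k w] rev[of k w] w k unfolding kR by auto
  have "w < T" using small(1)[OF w] RT by simp
  then have "\<lfloor>x (T - w)\<rfloor> \<in> {2 - 1, 2}" "\<lfloor>y (T - w)\<rfloor> \<in> {2 - 1, 2}"
    using zigzag_floor_near[OF a zig(1), of "T - w" T 2] zigzag_floor_near[OF b zig(2), of "T - w" T 2] w T xT yT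
    by auto
  then show False
    using label_near_target s by (auto simp: lab_def)
qed

end

lemma not_illuminates_room: "\<not> illuminates room (pt (0, 0)) (pt (2, 2))"
proof
  assume "illuminates room (pt (0, 0)) (pt (2, 2))"
  then obtain a b T x y where ab: "a \<ge> 0" "b \<ge> 0" and tr: "traj a b T x y" and target: "x T = 2" "y T = 2"
    using traj_of_illuminates by blast
  have start: "x 0 = 0" "y 0 = 0" and ends: "0 \<in> {0..T}" "T \<in> {0..T}"
    using tr by (auto simp: traj_def)
  have "\<bar>x T - x 0\<bar> \<le> a * \<bar>T - 0\<bar>" "\<bar>y T - y 0\<bar> \<le> b * \<bar>T - 0\<bar>"
    using tr ends unfolding traj_def zigzag_def by blast+
  \<comment> \<open>A coordinate of speed 0 would stay at 0 and never become 2.\<close>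
  then have "a \<noteq> 0" "b \<noteq> 0" using target start by auto
  then show False
    using target_unreachable[OF _ _ tr target] ab by simp
qed

theorem mainTheorem3:
  shows "\<exists>vs x y. simple_polygon vs \<and> length vs = 22 \<and>
           x \<in> pregion vs \<and> y \<in> pregion vs \<and> x \<noteq> y \<and>
           \<not> illuminates vs x y"
proof (intro exI conjI)
  show "simple_polygon room" by (rule simple_polygon_room)
  show "length room = 22" by simp
  show "pt (0, 0) \<in> pregion room" "pt (2, 2) \<in> pregion room"
    by (simp_all add: pregion_room floors_def in_open_box_def)
  show "pt (0, 0) \<noteq> pt (2, 2)" by simp
  show "\<not> illuminates room (pt (0, 0)) (pt (2, 2))" by (rule not_illuminates_room)
qed

end
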